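(* Let $\Omega\subset\subset\mathbb{C}^n$ ($n\ge2$) be a pseudoconvex domain with smooth boundary. Then the Steinness index of $\Omega$ exists (i.e. $S(\Omega)\in[1,\infty)$) if and only if $\overline\Omega$ has a strong Stein neighborhood basis.
   Context: Smooth means $C^\infty$. A (global) defining function of $\Omega$ is a smooth real function $\rho$ on a neighborhood $V$ of $\overline\Omega$ with $\Omega=\{z\in V:\rho(z)<0\}$ and $d\rho\neq0$ on $\partial\Omega$. Steinness index: with $\overline\Omega^{\complement}=\mathbb{C}^n\setminus\overline\Omega$, $\widetilde\eta_\rho:=\inf\{\widetilde\eta>1: \rho^{\widetilde\eta}\text{ is strictly plurisubharmonic on }\overline\Omega^{\complement}\cap U\text{ for some neighborhood }U\text{ of }\partial\Omega\}$ (and $\widetilde\eta_\rho=\infty$ if there is no such $\widetilde\eta$); $S(\Omega):=\inf_\rho\widetilde\eta_\rho$ over all defining functions $\rho$ of $\Omega$. $\overline\Omega$ has a strong Stein neighborhood basis if there exist a defining function $\rho$ of $\Omega$ (defined on a neighborhood $V$ of $\overline\Omega$) and $\epsilon_0>0$ such that $\Omega_\epsilon:=\{z\in V:\rho(z)<\epsilon\}$ is pseudoconvex for all $0\le\epsilon<\epsilon_0$. *)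

theory Defs
  imports "HOL-Analysis.Analysis"
begin

text \<open>
  \<^term>\<open>Ck_on k f S\<close> is meant for open \<^term>\<open>S\<close> in a finite-dimensional domain, where continuity of
  all iterated directional derivatives of order at most \<^term>\<open>k\<close> is the usual notion of class
  $C^k$. Differentiability is over the reals throughout, also on complex vector spaces.
\<close>

primrec Ck_on ::
  "nat \<Rightarrow> ('a::real_normed_vector \<Rightarrow> 'b::real_normed_vector) \<Rightarrow> 'a set \<Rightarrow> bool" where
  "Ck_on 0 f S \<longleftrightarrow> continuous_on S f"
| "Ck_on (Suc k) f S \<longleftrightarrow>
     (\<forall>x\<in>S. f differentiable (at x)) \<and> (\<forall>v. Ck_on k (\<lambda>x. frechet_derivative f (at x) v) S)"

definition smooth_on ::
  "('a::real_normed_vector \<Rightarrow> 'b::real_normed_vector) \<Rightarrow> 'a set \<Rightarrow> bool" where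
  "smooth_on f S \<longleftrightarrow> (\<forall>k. Ck_on k f S)"

text \<open>The Wirtinger derivatives $\partial/\partial z_j$ and $\partial/\partial\bar z_j$.\<close>

definition dz :: "'n::finite \<Rightarrow> (complex^'n \<Rightarrow> complex) \<Rightarrow> complex^'n \<Rightarrow> complex" where
  "dz j f z = (frechet_derivative f (at z) (axis j 1)
               - \<i> * frechet_derivative f (at z) (axis j \<i>)) / 2"

definition dzbar :: "'n::finite \<Rightarrow> (complex^'n \<Rightarrow> complex) \<Rightarrow> complex^'n \<Rightarrow> complex" where
  "dzbar j f z = (frechet_derivative f (at z) (axis j 1)
                  + \<i> * frechet_derivative f (at z) (axis j \<i>)) / 2"

text \<open>The sum is real for real-valued \<^term>\<open>u\<close> of class $C^2$, so \<^const>\<open>Re\<close> only adjusts the type.\<close>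

definition levi_form :: "(complex^'n::finite \<Rightarrow> real) \<Rightarrow> complex^'n \<Rightarrow> complex^'n \<Rightarrow> real" where
  "levi_form u z w =
     Re (\<Sum>j\<in>UNIV. \<Sum>k\<in>UNIV. dz j (dzbar k (\<lambda>x. of_real (u x))) z * w $ j * cnj (w $ k))"

definition strictly_plurisubharmonic_on :: "(complex^'n::finite \<Rightarrow> real) \<Rightarrow> (complex^'n) set \<Rightarrow> bool" where
  "strictly_plurisubharmonic_on u S \<longleftrightarrow>
     Ck_on 2 u S \<and> (\<forall>z\<in>S. \<forall>w. w \<noteq> 0 \<longrightarrow> levi_form u z w > 0)"

text \<open>
  Continuous plurisubharmonic functions on an open set: the sub-mean value property on every
  closed disc contained in a complex line.
\<close>

definition cont_plurisubharmonic_on :: "(complex^'n::finite \<Rightarrow> real) \<Rightarrow> (complex^'n) set \<Rightarrow> bool" where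
  "cont_plurisubharmonic_on u S \<longleftrightarrow>
     continuous_on S u \<and>
     (\<forall>z w. (\<forall>\<zeta>. cmod \<zeta> \<le> 1 \<longrightarrow> z + \<zeta> *s w \<in> S) \<longrightarrow>
        u z \<le> 1 / (2 * pi) * integral {0..2 * pi} (\<lambda>t. u (z + cis t *s w)))"

text \<open>
  Pseudoconvexity of an arbitrary open set (no boundary regularity, not necessarily connected):
  there is a continuous plurisubharmonic exhaustion function.
\<close>

definition pseudoconvex :: "(complex^'n::finite) set \<Rightarrow> bool" where
  "pseudoconvex D \<longleftrightarrow>
     open D \<and>
     (\<exists>u. cont_plurisubharmonic_on u D \<and>
          (\<forall>c. compact (closure {z\<in>D. u z < c}) \<and> closure {z\<in>D. u z < c} \<subseteq> D))"

text \<open>Local defining functions near each boundary point.\<close>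

definition smooth_boundary :: "(complex^'n::finite) set \<Rightarrow> bool" where
  "smooth_boundary D \<longleftrightarrow>
     (\<forall>p\<in>frontier D. \<exists>U r. open U \<and> p \<in> U \<and> smooth_on (r :: complex^'n \<Rightarrow> real) U \<and>
        D \<inter> U = {z\<in>U. r z < 0} \<and> frechet_derivative r (at p) \<noteq> (\<lambda>_. 0))"

text \<open>Functions are total here, so a defining function comes with its neighbourhood \<^term>\<open>V\<close>.\<close>

definition defining_function ::
  "(complex^'n::finite) set \<Rightarrow> (complex^'n) set \<Rightarrow> (complex^'n \<Rightarrow> real) \<Rightarrow> bool" where
  "defining_function D V \<rho> \<longleftrightarrow>
     open V \<and> closure D \<subseteq> V \<and> smooth_on \<rho> V \<and> D = {z\<in>V. \<rho> z < 0} \<and>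
     (\<forall>p\<in>frontier D. frechet_derivative \<rho> (at p) \<noteq> (\<lambda>_. 0))"

text \<open>
  The infimum is taken in \<^typ>\<open>ereal\<close>, where the infimum of the empty set is \<^term>\<open>\<infinity>::ereal\<close>.
  The neighbourhood \<^term>\<open>U\<close> has to lie in \<^term>\<open>V\<close>, as \<^term>\<open>\<rho>\<close> is meaningless elsewhere; on
  \<^term>\<open>U - closure D\<close> one has \<^term>\<open>\<rho> z \<ge> 0\<close>, so \<^term>\<open>\<rho> z powr \<eta>\<close> is the usual real power.
\<close>

definition steinness_exponent ::
  "(complex^'n::finite) set \<Rightarrow> (complex^'n) set \<Rightarrow> (complex^'n \<Rightarrow> real) \<Rightarrow> ereal" where
  "steinness_exponent D V \<rho> =
     Inf {ereal \<eta> | \<eta>. \<eta> > 1 \<and>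
            (\<exists>U. open U \<and> frontier D \<subseteq> U \<and> U \<subseteq> V \<and>
                 strictly_plurisubharmonic_on (\<lambda>z. \<rho> z powr \<eta>) (U - closure D))}"

definition steinness_index :: "(complex^'n::finite) set \<Rightarrow> ereal" where
  "steinness_index D = Inf {steinness_exponent D V \<rho> | V \<rho>. defining_function D V \<rho>}"

definition strong_stein_nbhd_basis :: "(complex^'n::finite) set \<Rightarrow> bool" where
  "strong_stein_nbhd_basis D \<longleftrightarrow>
     (\<exists>V \<rho> \<epsilon>\<^sub>0. defining_function D V \<rho> \<and> \<epsilon>\<^sub>0 > 0 \<and>
        (\<forall>\<epsilon>. 0 \<le> \<epsilon> \<and> \<epsilon> < \<epsilon>\<^sub>0 \<longrightarrow> pseudoconvex {z\<in>V. \<rho> z < \<epsilon>}))"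

end

theory Submission
  imports Defs
begin

text \<open>
  If \<open>\<rho> powr \<eta>\<close> is strictly plurisubharmonic outside the closed domain, then \<open>max \<rho> (\<epsilon> / 2) powr \<eta>\<close> is
  plurisubharmonic on all of \<open>{\<rho> < \<epsilon>}\<close>, and the reciprocal of its distance to \<open>\<epsilon> powr \<eta>\<close> is an
  exhaustion. The sub-mean value inequality on large discs comes from the maximum principle,
  comparing with real parts of polynomials that approximate the boundary values uniformly.

  Conversely, pseudoconvexity of all sublevel sets makes the Levi form of \<open>\<rho>\<close> nonnegative on complex
  tangent vectors at every nearby exterior point: otherwise the maximum principle on parabolic
  discs that approach the boundary would contradict the blow-up of the exhaustion. Hence
  \<open>L\<^sub>\<rho>(w) \<ge> - C |\<partial>\<rho>(w)| |w|\<close> with no term in \<open>\<rho> |w|\<^sup>2\<close>. The defining function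
  \<open>\<rho> exp (M exp (K |z|\<^sup>2))\<close> with \<open>M = N / \<eta>\<close> then works for all large \<open>\<eta>\<close>: the weight
  \<open>\<psi> = exp (K |z|\<^sup>2)\<close> satisfies \<open>L\<^sub>\<psi>(w) > C |\<partial>\<psi>(w)| |w|\<close>, which is what is needed to absorb the cross
  term between \<open>\<partial>\<rho>\<close> and \<open>\<partial>\<psi>\<close>.
\<close>

section \<open>Calculus of $C^k$ functions\<close>

text \<open>The exhaustions are merely continuous, and their plurisubharmonicity is tested on affine
  discs of every size. This shapes both directions. The power of \<open>\<rho>\<close> only offers
  pointwise second derivatives, so a passage from local to global is needed. In the converse the
  discs pressing against the boundary are curved, so the exhaustion is maximised over a solid tube
  about a parabola, with a penalty for leaving the parabola.

  Every exterior point near the boundary lies on the boundary of its own pseudoconvex sublevel set.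
  A Levi condition on the boundary of the domain alone would leave an error proportional to
  \<open>\<rho> |w|\<^sup>2\<close>; in the Levi form of a power it is divided by
  \<open>\<rho>\<close> and multiplied by \<open>\<eta>\<close>, and a weight that is fixed while
  \<open>\<eta>\<close> grows cannot absorb it.

  The weight must be exponential: the inequality required of \<open>\<psi>\<close> is homogeneous in
  \<open>\<psi>\<close>, so multiplying \<open>|z|\<^sup>2\<close> by a constant gains nothing,
  whereas \<open>exp (K |z|\<^sup>2)\<close> adds to its Levi form a term quadratic in its own
  gradient.\<close>

lemma frechet_derivative_cong_open:
  assumes "open S" "x \<in> S" "\<And>y. y \<in> S \<Longrightarrow> f y = g y"
  shows "frechet_derivative f (at x) = frechet_derivative g (at x)"
proof -
  have "(f has_derivative f') (at x) \<longleftrightarrow> (g has_derivative f') (at x)" for f'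
    using has_derivative_transform_within_open[of f f' x UNIV S g]
      has_derivative_transform_within_open[of g f' x UNIV S f] assms by auto
  then show ?thesis by (simp add: frechet_derivative_def)
qed

lemma differentiable_cong_open:
  assumes "open S" "x \<in> S" "\<And>y. y \<in> S \<Longrightarrow> f y = g y" "f differentiable (at x)"
  shows "g differentiable (at x)"
  using assms has_derivative_transform_within_open[of f _ x UNIV S g]
  unfolding differentiable_def by blast

lemma Ck_on_cong:
  assumes "open S" "\<And>y. y \<in> S \<Longrightarrow> f y = g y" "Ck_on k f S"
  shows "Ck_on k g S"
  using assms(2,3)
proof (induction k arbitrary: f g)
  case 0
  then show ?case using continuous_on_cong[of S S f g] by simp
next
  case (Suc k)
  have "Ck_on k (\<lambda>x. frechet_derivative g (at x) v) S" for v
  proof (rule Suc.IH)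
    show "Ck_on k (\<lambda>x. frechet_derivative f (at x) v) S" using Suc.prems(2) by simp
    show "frechet_derivative f (at y) v = frechet_derivative g (at y) v" if "y \<in> S" for y
      using frechet_derivative_cong_open[OF assms(1) that Suc.prems(1)] by simp
  qed
  moreover have "g differentiable (at x)" if "x \<in> S" for x
    using differentiable_cong_open[OF assms(1) that Suc.prems(1)] Suc.prems(2) that by simp
  ultimately show ?case by simp
qed

lemma Ck_on_subset: "Ck_on k f S \<Longrightarrow> T \<subseteq> S \<Longrightarrow> Ck_on k f T"
  by (induction k arbitrary: f) (auto intro: continuous_on_subset)

lemma Ck_on_Suc_D: "Ck_on (Suc k) f S \<Longrightarrow> Ck_on k f S"
proof (induction k arbitrary: f)
  case 0
  then show ?case
    by (auto intro!: continuous_at_imp_continuous_on differentiable_imp_continuous_within)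
next
  case (Suc k)
  have "Ck_on (Suc k) (\<lambda>x. frechet_derivative f (at x) v) S" for v
    using Suc.prems by simp
  then have "Ck_on k (\<lambda>x. frechet_derivative f (at x) v) S" for v
    by (rule Suc.IH)
  then show ?case using Suc.prems by simp
qed

lemma Ck_on_continuous: "Ck_on k f S \<Longrightarrow> continuous_on S f"
proof (induction k)
  case (Suc k)
  then show ?case using Ck_on_Suc_D by blast
qed simp

lemma Ck_on_SucI:
  assumes "open S" "\<And>x. x \<in> S \<Longrightarrow> (f has_derivative f' x) (at x)"
    "\<And>v. Ck_on k (\<lambda>x. f' x v) S"
  shows "Ck_on (Suc k) f S"
proof -
  have "frechet_derivative f (at x) = f' x" if "x \<in> S" for x
    using assms(2)[OF that] frechet_derivative_at by metis
  then have "Ck_on k (\<lambda>x. frechet_derivative f (at x) v) S" for v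
    using Ck_on_cong[OF assms(1) _ assms(3)[of v], of "\<lambda>x. frechet_derivative f (at x) v"] by simp
  then show ?thesis using assms(2) by (auto simp: differentiable_def)
qed

lemma Ck_on_Suc_has_derivative:
  "Ck_on (Suc k) f S \<Longrightarrow> x \<in> S \<Longrightarrow> (f has_derivative frechet_derivative f (at x)) (at x)"
  using frechet_derivative_works[of f "at x"] by simp

lemma Ck_on_const: "open S \<Longrightarrow> Ck_on k (\<lambda>_. c) S"
proof (induction k arbitrary: c)
  case (Suc k)
  show ?case by (rule Ck_on_SucI[OF Suc.prems, where f' = "\<lambda>_ _. 0"]) (auto intro: Suc)
qed simp

lemma Ck_on_add:
  assumes "open S"
  shows "Ck_on k f S \<Longrightarrow> Ck_on k g S \<Longrightarrow> Ck_on k (\<lambda>x. f x + g x) S"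
proof (induction k arbitrary: f g)
  case (Suc k)
  show ?case
    by (rule Ck_on_SucI[OF assms,
          where f' = "\<lambda>x v. frechet_derivative f (at x) v + frechet_derivative g (at x) v"])
      (use Suc in \<open>auto intro!: has_derivative_add simp flip: frechet_derivative_works\<close>)
qed (auto intro: continuous_on_add)

lemma Ck_on_mult:
  fixes f g :: "'a::real_normed_vector \<Rightarrow> real"
  assumes "open S"
  shows "Ck_on k f S \<Longrightarrow> Ck_on k g S \<Longrightarrow> Ck_on k (\<lambda>x. f x * g x) S"
proof (induction k arbitrary: f g)
  case (Suc k)
  show ?case
  proof (rule Ck_on_SucI[OF assms])
    show "((\<lambda>x. f x * g x) has_derivative
        (\<lambda>v. f x * frechet_derivative g (at x) v + frechet_derivative f (at x) v * g x)) (at x)"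
      if "x \<in> S" for x
      using Ck_on_Suc_has_derivative[OF Suc.prems(1) that] Ck_on_Suc_has_derivative[OF Suc.prems(2) that]
      by (rule has_derivative_mult)
    show "Ck_on k (\<lambda>x. f x * frechet_derivative g (at x) v + frechet_derivative f (at x) v * g x) S" for v
      using Suc.prems Ck_on_Suc_D[OF Suc.prems(1)] Ck_on_Suc_D[OF Suc.prems(2)]
      by (intro Ck_on_add[OF assms] Suc.IH) auto
  qed
qed (auto intro: continuous_on_mult)

lemma Ck_on_exp:
  fixes f :: "'a::real_normed_vector \<Rightarrow> real"
  assumes "open S"
  shows "Ck_on k f S \<Longrightarrow> Ck_on k (\<lambda>x. exp (f x)) S"
proof (induction k)
  case (Suc k)
  show ?case
  proof (rule Ck_on_SucI[OF assms])
    show "((\<lambda>x. exp (f x)) has_derivative (\<lambda>v. exp (f x) * frechet_derivative f (at x) v)) (at x)"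
      if "x \<in> S" for x
      using has_derivative_exp[OF Ck_on_Suc_has_derivative[OF Suc.prems that]] by (simp add: mult.commute)
    show "Ck_on k (\<lambda>x. exp (f x) * frechet_derivative f (at x) v) S" for v
      using Suc Ck_on_Suc_D[OF Suc.prems] by (intro Ck_on_mult[OF assms]) auto
  qed
qed (auto intro: continuous_on_exp)

text \<open>The derivative factor \<open>1 / f\<close> is written as
  \<open>exp (- 1 * ln (f x))\<close>, so that the induction hypothesis for the logarithm itself,
  with the product and exponential rules, covers it.\<close>

lemma Ck_on_ln:
  fixes f :: "'a::real_normed_vector \<Rightarrow> real"
  assumes "open S" and pos: "\<And>x. x \<in> S \<Longrightarrow> f x > 0"
  shows "Ck_on k f S \<Longrightarrow> Ck_on k (\<lambda>x. ln (f x)) S"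
proof (induction k)
  case (Suc k)
  show ?case
  proof (rule Ck_on_SucI[OF assms(1)])
    show "((\<lambda>x. ln (f x)) has_derivative
        (\<lambda>v. exp (- 1 * ln (f x)) * frechet_derivative f (at x) v)) (at x)"
      if "x \<in> S" for x
      using has_derivative_ln[OF _ Ck_on_Suc_has_derivative[OF Suc.prems that], of ] pos[OF that]
      by (simp add: exp_minus mult.commute divide_inverse)
    show "Ck_on k (\<lambda>x. exp (- 1 * ln (f x)) * frechet_derivative f (at x) v) S" for v
      using Suc Ck_on_Suc_D[OF Suc.prems]
      by (intro Ck_on_mult[OF assms(1)] Ck_on_exp[OF assms(1)] Ck_on_const[OF assms(1)]) auto
  qed
next
  case 0
  then show ?case using pos by (force intro!: continuous_on_ln)
qed

lemma Ck_on_inner_const: 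
  fixes v :: "'a::real_inner"
  assumes "open S" shows "Ck_on k (\<lambda>x. v \<bullet> x) S"
proof (cases k)
  case (Suc m)
  show ?thesis unfolding Suc
    by (rule Ck_on_SucI[OF assms, where f' = "\<lambda>_ h. v \<bullet> h"])
      (auto intro!: derivative_eq_intros Ck_on_const assms)
qed (auto intro!: continuous_intros)

lemma Ck_on_inner_self:
  fixes S :: "'a::real_inner set"
  assumes "open S" shows "Ck_on k (\<lambda>x. x \<bullet> x) S"
proof (cases k)
  case (Suc m)
  show ?thesis unfolding Suc
    by (rule Ck_on_SucI[OF assms, where f' = "\<lambda>x h. 2 * (h \<bullet> x)"])
      (auto intro!: derivative_eq_intros Ck_on_mult Ck_on_const assms
        Ck_on_inner_const simp: inner_commute)
qed (auto intro!: continuous_intros)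

lemma Ck_on_powr:
  fixes f :: "'a::real_normed_vector \<Rightarrow> real"
  assumes "open S" "\<And>x. x \<in> S \<Longrightarrow> f x > 0" "Ck_on k f S"
  shows "Ck_on k (\<lambda>x. f x powr a) S"
  using assms(2)
  by (intro Ck_on_cong[OF assms(1) _ Ck_on_exp[OF assms(1)
        Ck_on_mult[OF assms(1) Ck_on_const[OF assms(1), of _ a] Ck_on_ln[OF assms]]]])
    (force simp: powr_def)

text \<open>Differentiation is in direction \<open>b\<close> first and in direction \<open>a\<close>
  afterwards. The two mixed values are kept apart; expanding a quadratic form produces their
  sum.\<close>

definition d2 :: "('a::real_normed_vector \<Rightarrow> real) \<Rightarrow> 'a \<Rightarrow> 'a \<Rightarrow> 'a \<Rightarrow> real" where
  "d2 f x a b = frechet_derivative (\<lambda>y. frechet_derivative f (at y) b) (at x) a"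

lemma
  assumes "open S" "Ck_on 2 f S" "x \<in> S"
  shows C2_has_derivative: "(f has_derivative frechet_derivative f (at x)) (at x)"
    and C2_has_derivative2:
      "((\<lambda>y. frechet_derivative f (at y) b) has_derivative (\<lambda>a. d2 f x a b)) (at x)"
    and C2_linear: "linear (frechet_derivative f (at x))"
    and d2_linear1: "linear (\<lambda>a. d2 f x a b)"
    and d2_linear2: "linear (\<lambda>b. d2 f x a b)"
proof -
  have 1: "Ck_on (Suc (Suc 0)) f S" using assms(2) by (simp add: numeral_2_eq_2)
  have D: "(f has_derivative frechet_derivative f (at x)) (at x)" if "x \<in> S" for x
    using Ck_on_Suc_has_derivative[OF 1 that] .
  then have lin: "linear (frechet_derivative f (at x))" if "x \<in> S" for x
    using that has_derivative_linear by blast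
  show "(f has_derivative frechet_derivative f (at x)) (at x)" "linear (frechet_derivative f (at x))"
    using D lin assms(3) by auto
  have 2: "Ck_on (Suc 0) (\<lambda>y. frechet_derivative f (at y) b) S" for b using 1 by auto
  show D2: "((\<lambda>y. frechet_derivative f (at y) b) has_derivative (\<lambda>a. d2 f x a b)) (at x)" for b
    using Ck_on_Suc_has_derivative[OF 2 assms(3)] by (simp add: d2_def)
  then show "linear (\<lambda>a. d2 f x a b)" using has_derivative_linear by blast
  show "linear (\<lambda>b. d2 f x a b)"
  proof
    fix b c and r :: real
    \<comment> \<open>Linearity in the inner direction comes from uniqueness of the derivative: at
      all points near \<open>x\<close> the first derivative is linear, so both sides differentiate
      the same function.\<close>
    have "((\<lambda>y. frechet_derivative f (at y) (b + c)) has_derivative (\<lambda>a. d2 f x a b + d2 f x a c)) (at x)"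
      by (rule has_derivative_transform_within_open[OF has_derivative_add[OF D2[of b] D2[of c]] assms(1,3)])
        (simp add: lin linear_add)
    then have "(\<lambda>a. d2 f x a (b + c)) = (\<lambda>a. d2 f x a b + d2 f x a c)"
      by (rule has_derivative_unique[OF D2])
    then show "d2 f x a (b + c) = d2 f x a b + d2 f x a c" by (rule fun_cong)
    have "((\<lambda>y. frechet_derivative f (at y) (r *\<^sub>R b)) has_derivative (\<lambda>a. r *\<^sub>R d2 f x a b)) (at x)"
      by (rule has_derivative_transform_within_open[OF has_derivative_scaleR_right[OF D2[of b]] assms(1,3)])
        (simp add: lin linear_scale)
    then have "(\<lambda>a. d2 f x a (r *\<^sub>R b)) = (\<lambda>a. r *\<^sub>R d2 f x a b)"
      by (rule has_derivative_unique[OF D2])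
    then show "d2 f x a (r *\<^sub>R b) = r *\<^sub>R d2 f x a b" by (rule fun_cong)
  qed
qed

lemma C2_continuous_derivative:
  assumes "Ck_on 2 f S"
  shows "continuous_on S (\<lambda>x. frechet_derivative f (at x) v)" "continuous_on S (\<lambda>x. d2 f x a b)"
proof -
  show "continuous_on S (\<lambda>x. d2 f x a b)"
    using assms unfolding numeral_2_eq_2 d2_def by simp
  have "Ck_on (Suc (Suc 0)) f S" using assms by (simp add: numeral_2_eq_2)
  then have "Ck_on (Suc 0) (\<lambda>x. frechet_derivative f (at x) v) S"
    using Ck_on.simps(2)[of "Suc 0" f S] by blast
  then show "continuous_on S (\<lambda>x. frechet_derivative f (at x) v)"
    by (rule Ck_on_continuous)
qed

lemma d2_eqI:
  assumes "open S" "x \<in> S" "\<And>y. y \<in> S \<Longrightarrow> (f has_derivative f' y) (at y)"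
    "((\<lambda>y. f' y b) has_derivative g) (at x)"
  shows "d2 f x a b = g a"
proof -
  have "frechet_derivative f (at y) = f' y" if "y \<in> S" for y
    using assms(3)[OF that] frechet_derivative_at by metis
  then have "((\<lambda>y. frechet_derivative f (at y) b) has_derivative g) (at x)"
    by (intro has_derivative_transform_within_open[OF assms(4,1,2)]) simp
  then show ?thesis unfolding d2_def using frechet_derivative_at by metis
qed

section \<open>The mean value inequality on discs\<close>

text \<open>If \<open>l\<close> were positive, then \<open>g'\<close>, which vanishes at 0, would be
  positive just to the right of 0, and the mean value theorem would make \<open>g\<close> exceed
  \<open>g 0\<close>. The derivative of \<open>g'\<close> enters at 0 alone.\<close>

lemma second_derivative_local_max:
  fixes g :: "real \<Rightarrow> real"
  assumes "0 < e" and g: "\<And>s. \<bar>s\<bar> < e \<Longrightarrow> (g has_real_derivative g' s) (at s)"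
    and l: "(g' has_real_derivative l) (at 0)"
    and max: "\<And>s. \<bar>s\<bar> < e \<Longrightarrow> g s \<le> g 0"
  shows "l \<le> 0"
proof (rule ccontr)
  assume "\<not> l \<le> 0"
  then have "0 < l" by simp
  then obtain d where d: "0 < d" "\<And>h. 0 < h \<Longrightarrow> h < d \<Longrightarrow> g' 0 < g' (0 + h)"
    using DERIV_pos_inc_right[OF l] by blast
  have g0: "g' 0 = 0"
    using DERIV_local_max[OF g[of 0] \<open>0 < e\<close>] max \<open>0 < e\<close> by simp
  define h where "h = min d e / 2"
  have h: "0 < h" "h < d" "h < e" using d(1) \<open>0 < e\<close> by (auto simp: h_def)
  obtain z where z: "0 < z" "z < h" "g h - g 0 = (h - 0) * g' z"
    using MVT2[OF h(1), of g g'] g h by force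
  have "0 < g' z" using d(2)[of z] z h g0 by simp
  then have "0 < g h - g 0" using z(3) h(1) by simp
  then show False using max[of h] h by simp
qed

lemma C2_line:
  assumes "open S" "Ck_on 2 f S" "z + s *\<^sub>R v \<in> S"
  shows "((\<lambda>s. f (z + s *\<^sub>R v)) has_real_derivative frechet_derivative f (at (z + s *\<^sub>R v)) v) (at s)"
    and "((\<lambda>s. frechet_derivative f (at (z + s *\<^sub>R v)) b) has_real_derivative d2 f (z + s *\<^sub>R v) v b) (at s)"
proof -
  have l: "((\<lambda>s. z + s *\<^sub>R v) has_derivative (\<lambda>h. h *\<^sub>R v)) (at s)"
    by (auto intro!: derivative_eq_intros)
  have "((\<lambda>s. f (z + s *\<^sub>R v)) has_derivative (\<lambda>h. frechet_derivative f (at (z + s *\<^sub>R v)) (h *\<^sub>R v))) (at s)"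
    by (rule has_derivative_compose[OF l C2_has_derivative[OF assms]])
  then show "((\<lambda>s. f (z + s *\<^sub>R v)) has_real_derivative frechet_derivative f (at (z + s *\<^sub>R v)) v) (at s)"
    using C2_linear[OF assms] by (simp add: has_field_derivative_def linear_scale mult_commute_abs)
  have "((\<lambda>s. frechet_derivative f (at (z + s *\<^sub>R v)) b) has_derivative (\<lambda>h. d2 f (z + s *\<^sub>R v) (h *\<^sub>R v) b)) (at s)"
    by (rule has_derivative_compose[OF l C2_has_derivative2[OF assms]])
  then show "((\<lambda>s. frechet_derivative f (at (z + s *\<^sub>R v)) b) has_real_derivative d2 f (z + s *\<^sub>R v) v b) (at s)"
    using linear_scale[OF d2_linear1[OF assms, of b]]
    by (simp add: has_field_derivative_def mult_commute_abs)
qed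

section \<open>Real trigonometric polynomials as boundary values of real parts of holomorphic
  polynomials\<close>

definition trig_re :: "(complex \<Rightarrow> real) \<Rightarrow> bool" where
  "trig_re f \<longleftrightarrow> (\<exists>P. \<forall>z. cmod z = 1 \<longrightarrow> f z = Re (poly P z))"

lemma trig_re_const: "trig_re (\<lambda>_. c)"
  unfolding trig_re_def by (rule exI[of _ "[:of_real c:]"]) simp

lemma trig_re_add: "trig_re f \<Longrightarrow> trig_re g \<Longrightarrow> trig_re (\<lambda>z. f z + g z)"
  unfolding trig_re_def by (metis plus_complex.sel(1) poly_add)

lemma trig_re_cong: "(\<And>z. cmod z = 1 \<Longrightarrow> f z = g z) \<Longrightarrow> trig_re f \<Longrightarrow> trig_re g"
  unfolding trig_re_def by metis

lemma trig_re_sum: "(\<And>i. i \<in> I \<Longrightarrow> trig_re (f i)) \<Longrightarrow> trig_re (\<lambda>z. \<Sum>i\<in>I. f i z)"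
  by (induction I rule: infinite_finite_induct) (auto intro: trig_re_const trig_re_add)

lemma trig_re_monom: "trig_re (\<lambda>z. Re (c * z ^ k))"
  unfolding trig_re_def by (rule exI[of _ "monom c k"]) (simp add: poly_monom)

text \<open>On the unit circle \<open>cnj z\<close> is the inverse of \<open>z\<close>, so the
  product is a power of \<open>z\<close> or the conjugate of one, and the real part does not see the
  conjugation.\<close>

lemma trig_re_monom_cnj: "trig_re (\<lambda>z. Re (c * z ^ j * cnj (z ^ k)))"
proof (cases "k \<le> j")
  case True
  have "z ^ j * cnj (z ^ k) = z ^ (j - k)" if "cmod z = 1" for z
  proof -
    have "z ^ k * cnj (z ^ k) = 1" using that by (simp add: norm_power flip: complex_norm_square complex_cnj_power)
    then show ?thesis using True
      by (metis le_add_diff_inverse2 mult.assoc mult.right_neutral power_add)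
  qed
  then show ?thesis
    by (intro trig_re_cong[OF _ trig_re_monom[of c "j - k"]]) (simp add: mult.assoc)
next
  case False
  have "cnj (c * z ^ j * cnj (z ^ k)) = cnj c * z ^ (k - j)" if "cmod z = 1" for z
  proof -
    have "z ^ j * cnj (z ^ j) = 1" using that by (simp add: norm_power flip: complex_norm_square complex_cnj_power)
    moreover have "z ^ k = z ^ (k - j) * z ^ j" using False by (simp flip: power_add)
    ultimately show ?thesis by (simp add: mult.assoc) (metis mult.right_neutral mult.assoc mult.commute)
  qed
  then have "Re (cnj c * z ^ (k - j)) = Re (c * z ^ j * cnj (z ^ k))" if "cmod z = 1" for z
    using that by (metis complex_cnj_cnj cnj.sel(1))
  then show ?thesis
    by (intro trig_re_cong[OF _ trig_re_monom[of "cnj c" "k - j"]])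
qed

text \<open>A product of two harmonic functions is rarely harmonic, but only values on the circle
  matter here. There \<open>2 Re a Re b = Re (a b) + Re (a cnj b)\<close> turns products of
  monomials into the two preceding types. Hence the class is an algebra and contains all
  restrictions of real polynomials, which is what Stone-Weierstrass needs.\<close>

lemma trig_re_mult:
  assumes "trig_re f" "trig_re g"
  shows "trig_re (\<lambda>z. f z * g z)"
proof -
  obtain P Q where P: "\<And>z. cmod z = 1 \<Longrightarrow> f z = Re (poly P z)"
    and Q: "\<And>z. cmod z = 1 \<Longrightarrow> g z = Re (poly Q z)"
    using assms by (auto simp: trig_re_def)
  have re: "Re a * Re b = Re (1/2 * a * b) + Re (1/2 * a * cnj b)" for a b
    by (simp add: field_simps)
  have "trig_re (\<lambda>z. \<Sum>i\<le>degree P. \<Sum>j\<le>degree Q.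
      Re (1/2 * coeff P i * coeff Q j * z ^ (i + j)) + Re (1/2 * coeff P i * cnj (coeff Q j) * z ^ i * cnj (z ^ j)))"
    by (intro trig_re_sum trig_re_add trig_re_monom trig_re_monom_cnj)
  moreover have "(\<Sum>i\<le>degree P. \<Sum>j\<le>degree Q.
      Re (1/2 * coeff P i * coeff Q j * z ^ (i + j)) + Re (1/2 * coeff P i * cnj (coeff Q j) * z ^ i * cnj (z ^ j)))
      = f z * g z" if "cmod z = 1" for z
  proof -
    have "f z * g z = (\<Sum>i\<le>degree P. \<Sum>j\<le>degree Q. Re (coeff P i * z ^ i) * Re (coeff Q j * z ^ j))"
      unfolding P[OF that] Q[OF that] poly_altdef Re_sum sum_product ..
    also have "\<dots> = (\<Sum>i\<le>degree P. \<Sum>j\<le>degree Q.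
      Re (1/2 * coeff P i * coeff Q j * z ^ (i + j)) + Re (1/2 * coeff P i * cnj (coeff Q j) * z ^ i * cnj (z ^ j)))"
      unfolding re by (intro sum.cong refl) (simp add: power_add mult_ac)
    finally show ?thesis by simp
  qed
  ultimately show ?thesis by (rule trig_re_cong[rotated])
qed

lemma trig_re_real_polynomial: "real_polynomial_function f \<Longrightarrow> trig_re f"
proof (induction rule: real_polynomial_function.induct)
  case (linear f)
  interpret bounded_linear f by fact
  have "f z = Re ((of_real (f 1) - \<i> * of_real (f \<i>)) * z ^ 1)" for z
  proof -
    have "z = Re z *\<^sub>R 1 + Im z *\<^sub>R \<i>" by (simp add: complex_eq_iff)
    then have "f z = Re z * f 1 + Im z * f \<i>" by (metis add scale real_scaleR_def)
    then show ?thesis by simp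
  qed
  then show ?case
    by (intro trig_re_cong[OF _ trig_re_monom[of "of_real (f 1) - \<i> * of_real (f \<i>)" 1]]) (rule sym)
qed (auto intro: trig_re_const trig_re_add trig_re_mult)

lemma has_integral_Re_poly_circle:
  "((\<lambda>t. Re (poly P (cis t))) has_integral 2 * pi * Re (poly P 0)) {0..2 * pi}"
proof -
  have mon: "((\<lambda>t. Re (c * cis t ^ k)) has_integral (if k = 0 then 2 * pi * Re c else 0)) {0..2*pi}" for c k
  proof (cases "k = 0")
    case True
    then show ?thesis using has_integral_const_real[of "Re c" 0 "2 * pi"] by simp
  next
    case False
    have "((\<lambda>t. Re (- \<i> * c * cis (real k * t) / of_nat k)) has_vector_derivative Re (c * cis t ^ k)) (at t within {0..2*pi})" for t
      using False
      by (auto intro!: derivative_eq_intros simp: Complex.DeMoivre has_real_derivative_iff_has_vector_derivative[symmetric] field_simps)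
    then have "((\<lambda>t. Re (c * cis t ^ k)) has_integral
        Re (- \<i> * c * cis (real k * (2 * pi)) / of_nat k) - Re (- \<i> * c * cis (real k * 0) / of_nat k)) {0..2*pi}"
      by (intro fundamental_theorem_of_calculus) auto
    moreover have "cis (real k * (2 * pi)) = 1"
      by (metis Complex.DeMoivre cis_2pi power_one)
    ultimately show ?thesis using False by simp
  qed
  have "((\<lambda>t. \<Sum>k\<le>degree P. Re (coeff P k * cis t ^ k)) has_integral
      (\<Sum>k\<le>degree P. if k = 0 then 2 * pi * Re (coeff P k) else 0)) {0..2*pi}"
    by (intro has_integral_sum mon) auto
  then show ?thesis by (simp add: poly_altdef Re_sum poly_0_coeff_0 cong: if_cong)
qed

lemma DERIV_Re_poly_line:
  fixes v :: complex
  shows "((\<lambda>s. Re (a * poly P (z + of_real s * v))) has_real_derivative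
    Re (a * v * poly (pderiv P) (z + of_real s * v))) (at s)"
proof -
  have "((\<lambda>s. a * poly P (z + of_real s * v)) has_vector_derivative
    a * (v * poly (pderiv P) (z + of_real s * v))) (at s)"
    by (intro has_vector_derivative_mult_right
        field_vector_diff_chain_at[where f = "\<lambda>s. z + of_real s * v" and g = "poly P", unfolded o_def])
      (auto intro!: derivative_eq_intros poly_DERIV)
  then show ?thesis
    by (auto dest!: bounded_linear.has_vector_derivative[OF bounded_linear_Re] simp: has_real_derivative_iff_has_vector_derivative mult.assoc)
qed


text \<open>Second derivative at \<open>z\<close> in the real direction \<open>v\<close>: the first
  derivative has to exist on a whole segment, the second at \<open>z\<close> only. The values for
  \<open>v = 1\<close> and \<open>v = \<i>\<close> add up to the Laplacian.\<close>

definition line_d2 :: "(complex \<Rightarrow> real) \<Rightarrow> complex \<Rightarrow> complex \<Rightarrow> real \<Rightarrow> bool" where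
  "line_d2 g z v l \<longleftrightarrow> (\<exists>e>0. \<exists>g'.
     (\<forall>s. \<bar>s\<bar> < e \<longrightarrow> ((\<lambda>s. g (z + of_real s * v)) has_real_derivative g' s) (at s)) \<and>
     (g' has_real_derivative l) (at 0))"

lemma line_d2_add:
  assumes "line_d2 f z v l" "line_d2 g z v m"
  shows "line_d2 (\<lambda>y. f y + g y) z v (l + m)"
proof -
  obtain d f' where 1: "0 < d"
    "\<And>s. \<bar>s\<bar> < d \<Longrightarrow> ((\<lambda>s. f (z + of_real s * v)) has_real_derivative f' s) (at s)"
    "(f' has_real_derivative l) (at 0)"
    using assms(1) unfolding line_d2_def by metis
  obtain e g' where 2: "0 < e"
    "\<And>s. \<bar>s\<bar> < e \<Longrightarrow> ((\<lambda>s. g (z + of_real s * v)) has_real_derivative g' s) (at s)"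
    "(g' has_real_derivative m) (at 0)"
    using assms(2) unfolding line_d2_def by metis
  show ?thesis
    unfolding line_d2_def
    using 1 2 by (intro exI[of _ "min d e"] conjI exI[of _ "\<lambda>s. f' s + g' s"]) (auto intro!: DERIV_add)
qed

text \<open>The factor \<open>v * v\<close> is 1 for \<open>v = 1\<close> and -1 for
  \<open>v = \<i>\<close>, so the two values cancel: this is the harmonicity of the real
  part.\<close>

lemma line_d2_Re_poly: "line_d2 (\<lambda>y. Re (a * poly P y)) z v (Re (a * v * v * poly (pderiv (pderiv P)) z))"
  unfolding line_d2_def
  using DERIV_Re_poly_line[of a P z v] DERIV_Re_poly_line[of "a * v" "pderiv P" z v 0]
  by (intro exI[of _ 1] conjI exI[of _ "\<lambda>s. Re (a * v * poly (pderiv P) (z + of_real s * v))"])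
    (simp_all del: times_complex.sel)

lemma line_d2_norm_square: "line_d2 (\<lambda>y. d * (cmod y)\<^sup>2) z v (2 * d * (cmod v)\<^sup>2)"
proof -
  have eq: "d * (cmod (z + of_real s * v))\<^sup>2 =
      d * (cmod z)\<^sup>2 + 2 * d * s * Re (z * cnj v) + d * s\<^sup>2 * (cmod v)\<^sup>2" for s
    unfolding cmod_power2 by (simp add: power2_eq_square algebra_simps)
  show ?thesis
    unfolding line_d2_def eq
    by (intro exI[of _ 1] conjI exI[of _ "\<lambda>s. 2 * d * Re (z * cnj v) + 2 * d * s * (cmod v)\<^sup>2"])
      (auto intro!: derivative_eq_intros)
qed

lemma line_d2_local_max:
  assumes "line_d2 g z v l" "0 < e" "\<And>y. dist z y < e \<Longrightarrow> g y \<le> g z" "cmod v \<le> 1"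
  shows "l \<le> 0"
proof -
  obtain d g' where 1: "0 < d"
    "\<And>s. \<bar>s\<bar> < d \<Longrightarrow> ((\<lambda>s. g (z + of_real s * v)) has_real_derivative g' s) (at s)"
    "(g' has_real_derivative l) (at 0)"
    using assms(1) unfolding line_d2_def by metis
  have "g (z + of_real s * v) \<le> g (z + of_real 0 * v)" if "\<bar>s\<bar> < min d e" for s
  proof -
    have "\<bar>s\<bar> * cmod v \<le> \<bar>s\<bar>" using assms(4) by (simp add: mult_left_le)
    then have "dist z (z + of_real s * v) < e" using that by (simp add: dist_norm norm_mult)
    then show ?thesis using assms(3) by simp
  qed
  then show ?thesis
    using second_derivative_local_max[of "min d e" "\<lambda>s. g (z + of_real s * v)" g' l] 1 assms(2) by simp
qed

text \<open>A function that touches \<open>f\<close> from below at a point and has nonnegative Laplacian there rules out an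
  interior maximum of \<open>f - Re P + \<delta> |z|\<^sup>2\<close> at that point.\<close>

lemma lower_test_mean_value:
  fixes f :: "complex \<Rightarrow> real"
  assumes cont: "continuous_on (cball 0 1) f"
    and test: "\<And>z. cmod z < 1 \<Longrightarrow> \<exists>g e l m. 0 < e \<and> g z = f z \<and> (\<forall>y. dist z y < e \<longrightarrow> g y \<le> f y) \<and>
        line_d2 g z 1 l \<and> line_d2 g z \<i> m \<and> 0 \<le> l + m"
  shows "f 0 \<le> 1 / (2 * pi) * integral {0..2 * pi} (\<lambda>t. f (cis t))"
proof -
  have "continuous_on {0..2*pi} (\<lambda>t. f (cis t))"
    by (rule continuous_on_compose2[OF cont]) (auto intro!: continuous_intros)
  then have int: "(\<lambda>t. f (cis t)) integrable_on {0..2*pi}"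
    by (rule integrable_continuous_real)
  \<comment> \<open>Of the error \<open>3 * e\<close>, one \<open>e\<close> comes from the
    approximation on the circle and one from the added \<open>e * (cmod z)\<^sup>2\<close>, both in
    the bound for \<open>F\<close> on the circle; the third arises when the mean of
    \<open>Re P\<close> is compared with that of \<open>f\<close>.\<close>
  have main: "f 0 \<le> 1 / (2 * pi) * integral {0..2 * pi} (\<lambda>t. f (cis t)) + 3 * e" if e: "0 < e" for e
  proof -
    have "continuous_on (sphere 0 1) f" by (rule continuous_on_subset[OF cont]) auto
    then obtain h where h: "real_polynomial_function h" "\<And>z. z \<in> sphere 0 1 \<Longrightarrow> \<bar>f z - h z\<bar> < e"
      using Stone_Weierstrass_real_polynomial_function[of "sphere 0 1" f e] e by auto
    then obtain P where P: "\<And>z. cmod z = 1 \<Longrightarrow> \<bar>f z - Re (poly P z)\<bar> < e"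
      using trig_re_real_polynomial[OF h(1)] unfolding trig_re_def by force
    define F where "F = (\<lambda>z. f z + Re (- 1 * poly P z) + e * (cmod z)\<^sup>2)"
    have "continuous_on (cball 0 1) F"
      unfolding F_def by (intro continuous_intros cont)
    then obtain z where z: "cmod z \<le> 1" "\<And>y. cmod y \<le> 1 \<Longrightarrow> F y \<le> F z"
      using continuous_attains_sup[of "cball 0 1" F] by auto
    \<comment> \<open>At an interior maximum of \<open>F\<close> the function \<open>G\<close>,
      built from the test function \<open>g\<close>, also has a local maximum. Adding the second
      derivatives in directions 1 and \<open>\<i>\<close>, the polynomial drops out and
      \<open>l + m + 4 * e \<le> 0\<close> remains, which is absurd.\<close>
    have "cmod z = 1"
    proof (rule ccontr)
      assume "cmod z \<noteq> 1"
      then have z1: "cmod z < 1" using z by simp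
      then obtain g d l m where g: "0 < d" "g z = f z" "\<And>y. dist z y < d \<Longrightarrow> g y \<le> f y"
        "line_d2 g z 1 l" "line_d2 g z \<i> m" "0 \<le> l + m"
        using test[OF z1] by auto
      define G where "G = (\<lambda>y. g y + Re (- 1 * poly P y) + e * (cmod y)\<^sup>2)"
      have max: "G y \<le> G z" if "dist z y < min d (1 - cmod z)" for y
      proof -
        have "cmod y \<le> 1" using that norm_triangle_ineq2[of y z] by (simp add: dist_norm norm_minus_commute)
        then show ?thesis using z(2)[of y] g(2) g(3)[of y] that by (simp add: F_def G_def)
      qed
      have "l + Re (- 1 * 1 * 1 * poly (pderiv (pderiv P)) z) + 2 * e * (cmod 1)\<^sup>2 \<le> 0"
        by (rule line_d2_local_max[OF line_d2_add[OF line_d2_add[OF g(4) line_d2_Re_poly] line_d2_norm_square], of "min d (1 - cmod z)"])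
          (use g z1 max in \<open>auto simp: G_def\<close>)
      moreover have "m + Re (- 1 * \<i> * \<i> * poly (pderiv (pderiv P)) z) + 2 * e * (cmod \<i>)\<^sup>2 \<le> 0"
        by (rule line_d2_local_max[OF line_d2_add[OF line_d2_add[OF g(5) line_d2_Re_poly] line_d2_norm_square], of "min d (1 - cmod z)"])
          (use g z1 max in \<open>auto simp: G_def\<close>)
      ultimately show False using g(6) e by simp
    qed
    then have "F 0 \<le> 2 * e" using z(2)[of 0] P[of z] by (simp add: F_def)
    then have 1: "f 0 \<le> Re (poly P 0) + 2 * e" by (simp add: F_def)
    have "((\<lambda>t. Re (poly P (cis t)) - e) has_integral 2 * pi * Re (poly P 0) - 2 * pi * e) {0..2*pi}"
      using has_integral_diff[OF has_integral_Re_poly_circle[of P] has_integral_const_real[of e 0 "2*pi"]] by simp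
    moreover have "Re (poly P (cis t)) - e \<le> f (cis t)" for t using P[of "cis t"] by simp
    ultimately have "2 * pi * Re (poly P 0) - 2 * pi * e \<le> integral {0..2*pi} (\<lambda>t. f (cis t))"
      using has_integral_le[OF _ integrable_integral[OF int]] by blast
    then have "Re (poly P 0) - e \<le> 1 / (2 * pi) * integral {0..2*pi} (\<lambda>t. f (cis t))"
      by (simp add: field_simps)
    then show ?thesis using 1 by simp
  qed
  show ?thesis
  proof (rule field_le_epsilon)
    fix e :: real assume "0 < e"
    then show "f 0 \<le> 1 / (2 * pi) * integral {0..2 * pi} (\<lambda>t. f (cis t)) + e"
      using main[of "e / 3"] by simp
  qed
qed

section \<open>The Levi form\<close>

lemma linear_complex_vec_expand:
  fixes f :: "complex^'n::finite \<Rightarrow> real"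
  assumes "linear f"
  shows "f w = (\<Sum>j\<in>UNIV. Re (w $ j) * f (axis j 1) + Im (w $ j) * f (axis j \<i>))"
proof -
  have "w = (\<Sum>j\<in>UNIV. Re (w $ j) *\<^sub>R axis j 1 + Im (w $ j) *\<^sub>R axis j \<i>)"
    by (simp add: vec_eq_iff axis_def if_distrib if_distribR complex_eq_iff cong: if_cong)
  then have "f w = f (\<Sum>j\<in>UNIV. Re (w $ j) *\<^sub>R axis j 1 + Im (w $ j) *\<^sub>R axis j \<i>)" by simp
  also have "\<dots> = (\<Sum>j\<in>UNIV. Re (w $ j) * f (axis j 1) + Im (w $ j) * f (axis j \<i>))"
    using assms by (simp add: linear_sum linear_add linear_scale)
  finally show ?thesis .
qed

text \<open>The Levi form is a quarter of the Laplacian of \<open>u\<close> along the complex line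
  \<open>\<zeta> \<mapsto> z + \<zeta> *s w\<close>. All later estimates are made on this real
  quadratic form.\<close>

lemma levi_form_eq_d2:
  fixes u :: "complex^'n::finite \<Rightarrow> real"
  assumes S: "open S" "Ck_on 2 u S" "z \<in> S"
  shows "levi_form u z w = (d2 u z w w + d2 u z (\<i> *s w) (\<i> *s w)) / 4"
proof -
  let ?e = "\<lambda>j::'n. axis j (1::complex)" and ?f = "\<lambda>j::'n. axis j \<i>"
  have dzbar: "dzbar k (\<lambda>x. of_real (u x)) y =
     (of_real (frechet_derivative u (at y) (?e k)) + \<i> * of_real (frechet_derivative u (at y) (?f k))) / 2"
    if "y \<in> S" for y k
  proof -
    have "((\<lambda>x. complex_of_real (u x)) has_derivative (\<lambda>v. of_real (frechet_derivative u (at y) v))) (at y)"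
      by (rule has_derivative_of_real[OF C2_has_derivative[OF S(1,2) that]])
    then show ?thesis unfolding dzbar_def using frechet_derivative_at by metis
  qed
  have dz: "dz j (dzbar k (\<lambda>x. of_real (u x))) z =
      ((of_real (d2 u z (?e j) (?e k)) + \<i> * of_real (d2 u z (?e j) (?f k))) / 2 -
       \<i> * ((of_real (d2 u z (?f j) (?e k)) + \<i> * of_real (d2 u z (?f j) (?f k))) / 2)) / 2" for j k
  proof -
    have "((\<lambda>y. (of_real (frechet_derivative u (at y) (?e k)) + \<i> * of_real (frechet_derivative u (at y) (?f k))) / 2)
       has_derivative (\<lambda>v. (of_real (d2 u z v (?e k)) + \<i> * of_real (d2 u z v (?f k))) / 2)) (at z)"
      by (intro bounded_linear.has_derivative[OF bounded_linear_divide] has_derivative_add has_derivative_mult_right has_derivative_of_real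
          C2_has_derivative2[OF S])
    then have "(dzbar k (\<lambda>x. of_real (u x))
       has_derivative (\<lambda>v. (of_real (d2 u z v (?e k)) + \<i> * of_real (d2 u z v (?f k))) / 2)) (at z)"
      by (rule has_derivative_transform_within_open[OF _ S(1,3)]) (simp add: dzbar)
    then have "frechet_derivative (dzbar k (\<lambda>x. of_real (u x))) (at z) =
        (\<lambda>v. (of_real (d2 u z v (?e k)) + \<i> * of_real (d2 u z v (?f k))) / 2)"
      by (rule frechet_derivative_at[symmetric])
    then show ?thesis unfolding dz_def by simp
  qed
  have exp: "d2 u z a b = (\<Sum>j\<in>UNIV. \<Sum>k\<in>UNIV.
      Re (a $ j) * (Re (b $ k) * d2 u z (?e j) (?e k) + Im (b $ k) * d2 u z (?e j) (?f k)) +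
      Im (a $ j) * (Re (b $ k) * d2 u z (?f j) (?e k) + Im (b $ k) * d2 u z (?f j) (?f k)))" for a b
    by (subst linear_complex_vec_expand[OF d2_linear1[OF S, of b], of a])
      (simp only: linear_complex_vec_expand[OF d2_linear2[OF S], of _ b] sum_distrib_left sum.distrib[symmetric])
  show ?thesis
    unfolding levi_form_def dz exp[of w w] exp[of "\<i> *s w" "\<i> *s w"] Re_sum
      sum.distrib[symmetric] sum_divide_distrib
    by (intro sum.cong refl) (simp add: field_simps)
qed


lemma line_d2_const: "line_d2 (\<lambda>_. c) z v 0"
  unfolding line_d2_def by (intro exI[of _ 1] conjI exI[of _ "\<lambda>_. 0"]) auto

lemma scaleR_smult_vec: "(s *\<^sub>R v) = complex_of_real s *s (v::complex^'n)"
  by (simp add: vec_eq_iff) (simp add: scaleR_conv_of_real)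

lemma line_d2_C2:
  fixes u :: "complex^'n::finite \<Rightarrow> real"
  assumes S: "open S" "Ck_on 2 u S" "z + \<zeta> *s w \<in> S"
  shows "line_d2 (\<lambda>\<xi>. u (z + \<xi> *s w)) \<zeta> v (d2 u (z + \<zeta> *s w) (v *s w) (v *s w))"
proof -
  let ?x = "z + \<zeta> *s w" and ?v = "v *s w"
  have eq: "z + (\<zeta> + of_real s * v) *s w = ?x + s *\<^sub>R ?v" for s
    by (simp add: scaleR_smult_vec vec_eq_iff algebra_simps)
  obtain e where e: "0 < e" "ball ?x e \<subseteq> S" using S openE by blast
  \<comment> \<open>The added 1 keeps the quotient meaningful when \<open>?v\<close> is
    zero.\<close>
  define d where "d = e / (norm ?v + 1)"
  have d: "0 < d" using e by (simp add: d_def add_nonneg_pos)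
  have in_S: "?x + s *\<^sub>R ?v \<in> S" if "\<bar>s\<bar> < d" for s
  proof -
    have "\<bar>s\<bar> * norm ?v \<le> \<bar>s\<bar> * (norm ?v + 1)" by (intro mult_left_mono) auto
    also have "\<dots> < d * (norm ?v + 1)" using that by (intro mult_strict_right_mono) (auto intro: add_nonneg_pos)
    also have "\<dots> = e" by (simp add: d_def) (smt (verit) norm_ge_zero)
    finally show ?thesis using e(2) by (auto simp: dist_norm)
  qed
  show ?thesis
    unfolding line_d2_def eq
    using d in_S C2_line(1)[OF S(1,2), of ?x _ ?v] C2_line(2)[OF S(1,2), of ?x 0 ?v ?v] S(3)
    by (intro exI[of _ d] conjI exI[of _ "\<lambda>s. frechet_derivative u (at (?x + s *\<^sub>R ?v)) ?v"]) auto
qed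

section \<open>Neighborhoods of the boundary and the sign of a defining function\<close>

lemma compact_open_bounded_nbhd:
  fixes K W :: "'a::heine_borel set"
  assumes "compact K" "open W" "K \<subseteq> W"
  obtains U where "open U" "K \<subseteq> U" "closure U \<subseteq> W" "compact (closure U)"
proof (cases "K = {}")
  case True
  then show ?thesis using that[of "{}"] by simp
next
  case False
  obtain e where e: "0 < e" "{x. infdist x K \<le> e} \<subseteq> W"
    using compact_in_open_separated[OF False assms] by blast
  let ?U = "{x. infdist x K < e}"
  have "open ?U" by (intro open_Collect_less continuous_intros)
  moreover have "K \<subseteq> ?U" using e by auto
  moreover have c: "closure ?U \<subseteq> {x. infdist x K \<le> e}"
    by (rule closure_minimal) (auto intro!: closed_Collect_le continuous_intros)
  moreover have "compact (closure ?U)"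
    using compact_infdist_le[OF False assms(1) e(1)] c
    by (metis (no_types, lifting) closed_closure compact_Int_closed inf.absorb_iff2)
  ultimately show ?thesis using that e(2) by blast
qed

text \<open>A zero of \<open>\<rho>\<close> at which the derivative does not vanish is a limit of
  points with negative \<open>\<rho>\<close>, that is, of points of \<open>D\<close>. So off
  \<open>closure D\<close> a zero would have to be critical.\<close>

lemma pos_outside_closure:
  fixes \<rho> :: "'a::real_normed_vector \<Rightarrow> real"
  assumes "open V" "D = {z\<in>V. \<rho> z < 0}" "z \<in> V" "z \<notin> closure D"
    and der: "(\<rho> has_derivative \<rho>') (at z)" and "\<rho>' \<noteq> (\<lambda>_. 0)"
  shows "\<rho> z > 0"
proof (rule ccontr)
  assume "\<not> \<rho> z > 0"
  then have 0: "\<rho> z = 0" using assms closure_subset[of D] by force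
  have lin: "linear \<rho>'" using der has_derivative_linear by blast
  obtain v0 where "\<rho>' v0 \<noteq> 0" using assms(6) by blast
  then obtain v where v: "\<rho>' v < 0" using linear_neg[OF lin, of v0] by (metis neg_less_0_iff_less not_less_iff_gr_or_eq)
  have l: "((\<lambda>s. z + s *\<^sub>R v) has_derivative (\<lambda>h. h *\<^sub>R v)) (at (0::real))"
    by (auto intro!: derivative_eq_intros)
  have "((\<lambda>s. \<rho> (z + s *\<^sub>R v)) has_derivative (\<lambda>h. \<rho>' (h *\<^sub>R v))) (at 0)"
    using has_derivative_compose[OF l, of \<rho> \<rho>'] der by simp
  then have "((\<lambda>s. \<rho> (z + s *\<^sub>R v)) has_real_derivative \<rho>' v) (at 0)"
    using linear_scale[OF lin] by (simp add: has_field_derivative_def mult_commute_abs)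
  from DERIV_neg_dec_right[OF this v] obtain d where d: "0 < d" "\<And>h. 0 < h \<Longrightarrow> h < d \<Longrightarrow> \<rho> (z + h *\<^sub>R v) < 0"
    using 0 by auto
  have "((\<lambda>s. z + s *\<^sub>R v) \<longlongrightarrow> z + 0 *\<^sub>R v) (at_right 0)"
    by (intro tendsto_intros)
  then have lim: "((\<lambda>s. z + s *\<^sub>R v) \<longlongrightarrow> z) (at_right 0)" by simp
  then have "\<forall>\<^sub>F s in at_right 0. z + s *\<^sub>R v \<in> V"
    using assms(1,3) by (rule topological_tendstoD)
  moreover have "\<forall>\<^sub>F s in at_right 0. \<rho> (z + s *\<^sub>R v) < 0"
    using d by (auto simp: eventually_at_right_field)
  ultimately have "\<forall>\<^sub>F s in at_right 0. z + s *\<^sub>R v \<in> D"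
    by eventually_elim (simp add: assms(2))
  moreover have "\<forall>\<^sub>F s in at_right 0. z + s *\<^sub>R v \<in> - closure D"
    using lim assms(4) by (intro topological_tendstoD[of _ z]) auto
  ultimately have "\<forall>\<^sub>F s in at_right (0::real). False"
    by eventually_elim (use closure_subset in blast)
  then show False by simp
qed

lemma nonpos_on_closure:
  fixes \<rho> :: "'a::real_normed_vector \<Rightarrow> real"
  assumes "open V" "D = {z\<in>V. \<rho> z < 0}" "continuous_on V \<rho>" "z \<in> V" "z \<in> closure D"
  shows "\<rho> z \<le> 0"
proof (rule ccontr)
  assume "\<not> \<rho> z \<le> 0"
  moreover have "open {x\<in>V. \<rho> x > 0}"
    using continuous_on_open_vimage[OF assms(1), of \<rho>] assms(3)
    by (auto simp: vimage_def Int_def conj_commute dest!: spec[of _ "{0<..}"])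
  ultimately show False
    using assms open_Int_closure_eq_empty[of "{x\<in>V. \<rho> x > 0}" D] by auto
qed

lemma open_noncritical:
  fixes \<rho> :: "'a::real_normed_vector \<Rightarrow> real"
  assumes "open V" "Ck_on 2 \<rho> V"
  shows "open {z\<in>V. frechet_derivative \<rho> (at z) \<noteq> (\<lambda>_. 0)}"
proof -
  have "open {z\<in>V. frechet_derivative \<rho> (at z) v \<noteq> 0}" for v
    using continuous_on_open_vimage[OF assms(1), of "\<lambda>z. frechet_derivative \<rho> (at z) v"]
      C2_continuous_derivative(1)[OF assms(2), of v]
    by (auto simp: vimage_def Int_def conj_commute dest!: spec[of _ "- {0}"])
  then have "open (\<Union>v. {z\<in>V. frechet_derivative \<rho> (at z) v \<noteq> 0})" by blast
  also have "(\<Union>v. {z\<in>V. frechet_derivative \<rho> (at z) v \<noteq> 0}) = {z\<in>V. frechet_derivative \<rho> (at z) \<noteq> (\<lambda>_. 0)}"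
    by auto
  finally show ?thesis .
qed

section \<open>From the Steinness index to Stein neighborhoods\<close>

lemma continuous_on_smult_vec [continuous_intros]:
  fixes g :: "'a::topological_space \<Rightarrow> complex^'n"
  assumes "continuous_on X f" "continuous_on X g"
  shows "continuous_on X (\<lambda>x. f x *s g x)"
  unfolding vector_scalar_mult_def using assms by (intro continuous_intros)

lemma open_sublevel:
  fixes f :: "'a::topological_space \<Rightarrow> real"
  assumes "open V" "continuous_on V f"
  shows "open {z\<in>V. f z < c}"
proof -
  have "{z\<in>V. f z < c} = V \<inter> f -` {..<c}" by auto
  then show ?thesis
    using continuous_on_open_vimage[OF assms(1), of f] assms(2) by (metis inf_commute open_lessThan)
qed

text \<open>Jensen's inequality for the increasing convex function
  \<open>x \<mapsto> 1 / (A - x)\<close>: the reciprocal lies above its tangent at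
  \<open>f 0\<close>, and the linear part of the tangent has nonnegative integral by
  \<open>mean\<close>.\<close>

lemma mean_reciprocal_gap:
  fixes f :: "complex \<Rightarrow> real"
  assumes cont: "continuous_on (cball 0 1) f" and lt: "\<And>z. cmod z \<le> 1 \<Longrightarrow> f z < A"
    and mean: "f 0 \<le> 1 / (2 * pi) * integral {0..2 * pi} (\<lambda>t. f (cis t))"
  shows "1 / (A - f 0) \<le> 1 / (2 * pi) * integral {0..2 * pi} (\<lambda>t. 1 / (A - f (cis t)))"
proof -
  define b where "b = A - f 0"
  have b: "0 < b" using lt[of 0] by (simp add: b_def)
  have tangent: "1 / b + (f (cis t) - f 0) / b\<^sup>2 \<le> 1 / (A - f (cis t))" for t
  proof -
    define x where "x = A - f (cis t)"
    have x: "0 < x" using lt[of "cis t"] by (simp add: x_def)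
    have "0 \<le> (b - x)\<^sup>2 / (x * b\<^sup>2)" using x by simp
    also have "\<dots> = 1 / x - (1 / b + (b - x) / b\<^sup>2)"
      using x b by (simp add: field_simps power2_eq_square)
    finally show ?thesis by (simp add: x_def b_def)
  qed
  have c: "continuous_on {0..2*pi} (\<lambda>t. f (cis t))"
    by (rule continuous_on_compose2[OF cont]) (auto intro!: continuous_intros)
  have i1: "(\<lambda>t. f (cis t)) integrable_on {0..2*pi}"
    using c by (rule integrable_continuous_real)
  have i2: "(\<lambda>t. 1 / (A - f (cis t))) integrable_on {0..2*pi}"
    using lt by (intro integrable_continuous_real continuous_intros c) (metis norm_cis less_numeral_extra(3) diff_gt_0_iff_gt order_refl)
  have "((\<lambda>t. 1 / b + (f (cis t) - f 0) / b\<^sup>2) has_integral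
     2 * pi * (1 / b) + (integral {0..2*pi} (\<lambda>t. f (cis t)) - 2 * pi * f 0) / b\<^sup>2) {0..2*pi}"
    using has_integral_const_real[of "1 / b" 0 "2 * pi"] has_integral_const_real[of "f 0" 0 "2 * pi"]
    by (intro has_integral_add has_integral_divide has_integral_diff integrable_integral[OF i1]) auto
  from has_integral_le[OF this integrable_integral[OF i2] tangent]
  have "2 * pi * (1 / b) + (integral {0..2*pi} (\<lambda>t. f (cis t)) - 2 * pi * f 0) / b\<^sup>2
     \<le> integral {0..2*pi} (\<lambda>t. 1 / (A - f (cis t)))" .
  moreover have "0 \<le> (integral {0..2*pi} (\<lambda>t. f (cis t)) - 2 * pi * f 0) / b\<^sup>2"
    using mean by (simp add: field_simps)
  ultimately show ?thesis by (simp add: b_def field_simps)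
qed

lemma strictly_psh_levi_nonneg:
  assumes "open S" "strictly_plurisubharmonic_on u S" "z \<in> S"
  shows "0 \<le> d2 u z w w + d2 u z (\<i> *s w) (\<i> *s w)"
proof (cases "w = 0")
  case True
  then show ?thesis
    using linear_0[OF d2_linear1[OF assms(1) _ assms(3), of u]] assms(2)
    by (simp add: strictly_plurisubharmonic_on_def)
next
  case False
  then show ?thesis
    using levi_form_eq_d2[OF assms(1) _ assms(3), of u w] assms(2,3)
    by (force simp: strictly_plurisubharmonic_on_def)
qed

lemma strong_stein_if_spsh_power:
  fixes D :: "(complex^'n::finite) set"
  assumes D: "open D" "bounded D" "pseudoconvex D"
    and def: "defining_function D V \<rho>" and eta: "0 < \<eta>"
    and U: "open U" "frontier D \<subseteq> U" "U \<subseteq> V"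
    and psh: "strictly_plurisubharmonic_on (\<lambda>z. \<rho> z powr \<eta>) (U - closure D)"
  shows "strong_stein_nbhd_basis D"
proof -
  have V: "open V" "closure D \<subseteq> V" "D = {z\<in>V. \<rho> z < 0}" and C2: "Ck_on 2 \<rho> V"
    and smooth: "smooth_on \<rho> V" and fr: "\<And>p. p \<in> frontier D \<Longrightarrow> frechet_derivative \<rho> (at p) \<noteq> (\<lambda>_. 0)"
    using def by (auto simp: defining_function_def smooth_on_def)
  have cont: "continuous_on V \<rho>" using C2 by (rule Ck_on_continuous)
  \<comment> \<open>Restricting to noncritical points makes \<open>\<rho>\<close> strictly positive
    off \<open>closure D\<close>; \<open>V\<close> may contain further zeros farther out.\<close>
  define W where "W = U \<inter> {z\<in>V. frechet_derivative \<rho> (at z) \<noteq> (\<lambda>_. 0)}"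
  have "open W" "frontier D \<subseteq> W"
    using U open_noncritical[OF V(1) C2] fr by (auto simp: W_def)
  moreover have "compact (frontier D)" using D(2) compact_frontier_bounded by blast
  ultimately obtain U' where U': "open U'" "frontier D \<subseteq> U'" "closure U' \<subseteq> W" "compact (closure U')"
    using compact_open_bounded_nbhd by metis
  have pos: "0 < \<rho> z" if "z \<in> W" "z \<notin> closure D" for z
    using pos_outside_closure[OF V(1,3) _ that(2) C2_has_derivative[OF V(1) C2]] that(1) by (auto simp: W_def)
  \<comment> \<open>The sublevel sets in the given \<open>V\<close> need not be relatively compact
    in it, so the neighborhood is replaced by one with compact closure in \<open>V\<close>, whose
    part outside \<open>closure D\<close> lies in \<open>W\<close>.\<close>
  define V' where "V' = D \<union> U'"
  have clD: "closure D = D \<union> frontier D" using closure_Un_frontier by metis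
  have V': "open V'" "closure D \<subseteq> V'" "closure V' \<subseteq> V" "V' \<subseteq> V"
    using D(1) U' U(3) V(2) clD closure_subset[of U'] by (auto simp: V'_def W_def)
  have compV': "compact (closure V')"
    using D(2) U'(4) by (simp add: V'_def compact_Un)
  have defV': "defining_function D V' \<rho>"
    using V' def Ck_on_subset[of _ \<rho> V V'] closure_subset[of D]
    by (auto simp: defining_function_def smooth_on_def)
  obtain e1 where e1: "0 < e1" "\<And>z. z \<in> closure V' - V' \<Longrightarrow> e1 \<le> \<rho> z"
  proof (cases "closure V' - V' = {}")
    case False
    have "compact (closure V' - V')" using compV' V'(1) by (rule compact_diff)
    moreover have "continuous_on (closure V' - V') \<rho>" using cont V'(3) continuous_on_subset by blast
    ultimately obtain z where z: "z \<in> closure V' - V'" "\<And>y. y \<in> closure V' - V' \<Longrightarrow> \<rho> z \<le> \<rho> y"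
      using continuous_attains_inf[of "closure V' - V'" \<rho>] False by blast
    have "z \<in> W" "z \<notin> closure D" using z(1) V'(2) U'(3) clD by (auto simp: V'_def)
    then show thesis using that[of "\<rho> z"] pos z(2) by blast
  qed (use that[of 1] in auto)
  have "pseudoconvex {z\<in>V'. \<rho> z < \<epsilon>}" if \<epsilon>: "0 < \<epsilon>" "\<epsilon> < e1" for \<epsilon>
  proof -
    define K where "K = {z\<in>V'. \<rho> z \<le> \<epsilon>}"
    have "K = {z \<in> closure V'. \<rho> z \<le> \<epsilon>}"
      using e1(2) \<epsilon> closure_subset[of V'] by (force simp: K_def)
    moreover have "closed {z \<in> closure V'. \<rho> z \<le> \<epsilon>}"
      using cont V'(3) continuous_on_subset by (intro continuous_on_closed_Collect_le continuous_intros) auto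
    ultimately have K: "compact K"
      using compV' by (metis (no_types, lifting) compact_eq_bounded_closed bounded_subset mem_Collect_eq subsetI)
    \<comment> \<open>The power is known to be plurisubharmonic only off \<open>closure D\<close>.
      Cutting at the positive level \<open>\<epsilon> / 2\<close> makes \<open>\<phi>\<close>
      constant around \<open>closure D\<close> inside the sublevel set and changes nothing near its
      outer boundary.\<close>
    define \<phi> where "\<phi> = (\<lambda>z. max (\<rho> z) (\<epsilon> / 2) powr \<eta>)"
    define A where "A = \<epsilon> powr \<eta>"
    define B where "B = {z\<in>V'. \<rho> z < \<epsilon>}"
    have BV: "B \<subseteq> V" "B \<subseteq> K" using V'(4) by (auto simp: B_def K_def)
    have openB: "open B"
      unfolding B_def using V' cont continuous_on_subset by (intro open_sublevel) auto
    have cont\<phi>: "continuous_on V \<phi>"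
      unfolding \<phi>_def using cont \<epsilon> by (intro continuous_intros) auto
    have \<phi>A: "\<phi> z < A" if "z \<in> B" for z
      using that \<epsilon> eta by (auto simp: \<phi>_def A_def B_def intro!: powr_less_mono2)
    have \<phi>c: "(\<epsilon> / 2) powr \<eta> \<le> \<phi> z" for z
      using \<epsilon> eta by (auto simp: \<phi>_def intro!: powr_mono2)
    have submean: "\<phi> z \<le> 1 / (2 * pi) * integral {0..2 * pi} (\<lambda>t. \<phi> (z + cis t *s w))"
      and contf: "continuous_on (cball 0 1) (\<lambda>\<zeta>. \<phi> (z + \<zeta> *s w))"
      if disc: "\<forall>\<zeta>. cmod \<zeta> \<le> 1 \<longrightarrow> z + \<zeta> *s w \<in> B" for z w
    proof -
      have ca: "continuous_on X (\<lambda>\<zeta>. z + \<zeta> *s w)" for X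
        by (intro continuous_intros)
      show contf: "continuous_on (cball 0 1) (\<lambda>\<zeta>. \<phi> (z + \<zeta> *s w))"
        by (rule continuous_on_compose2[OF cont\<phi> ca]) (use disc BV in auto)
      \<comment> \<open>As \<open>\<phi>\<close> dominates both the constant and
        \<open>\<rho> powr \<eta>\<close>, whichever of them equals \<open>\<phi>\<close> at the
        point touches it from below: the constant has zero Laplacian, the power a nonnegative one.
        This also deals with the kink at \<open>\<rho> = \<epsilon> / 2\<close>.\<close>
      have "\<exists>g e l m. 0 < e \<and> g \<zeta> = \<phi> (z + \<zeta> *s w) \<and> (\<forall>y. dist \<zeta> y < e \<longrightarrow> g y \<le> \<phi> (z + y *s w)) \<and>
        line_d2 g \<zeta> 1 l \<and> line_d2 g \<zeta> \<i> m \<and> 0 \<le> l + m" if "cmod \<zeta> < 1" for \<zeta>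
      proof (cases "\<rho> (z + \<zeta> *s w) \<le> \<epsilon> / 2")
        case True
        then have "\<phi> (z + \<zeta> *s w) = (\<epsilon> / 2) powr \<eta>" by (simp add: \<phi>_def)
        then show ?thesis
          using \<phi>c line_d2_const
          by (intro exI[of _ "\<lambda>_. (\<epsilon> / 2) powr \<eta>"] exI[of _ 1] exI[of _ 0]) auto
      next
        case False
        define T where "T = (U' - closure D) \<inter> {x\<in>V. - \<rho> x < - \<epsilon> / 2}"
        have "open {x\<in>V. - \<rho> x < - \<epsilon> / 2}"
          by (intro open_sublevel V(1) continuous_intros cont)
        then have T: "open T" using U'(1) by (auto simp: T_def)
        have inB: "z + \<zeta> *s w \<in> B" using disc that by auto
        then have "z + \<zeta> *s w \<notin> closure D"
          using nonpos_on_closure[OF V(1,3) cont] False \<epsilon> BV by force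
        then have inT: "z + \<zeta> *s w \<in> T"
          using inB False clD BV by (auto simp: T_def B_def V'_def)
        have TU: "T \<subseteq> U - closure D" using U'(3) closure_subset[of U'] by (auto simp: T_def W_def)
        have psh': "strictly_plurisubharmonic_on (\<lambda>z. \<rho> z powr \<eta>) T"
          using psh TU Ck_on_subset unfolding strictly_plurisubharmonic_on_def by blast
        then have C2': "Ck_on 2 (\<lambda>z. \<rho> z powr \<eta>) T" by (simp add: strictly_plurisubharmonic_on_def)
        have "open ((\<lambda>\<zeta>. z + \<zeta> *s w) -` T)"
          using T ca[of UNIV] continuous_on_open_vimage[OF open_UNIV] by fastforce
        then obtain e where e: "0 < e" "\<And>y. dist \<zeta> y < e \<Longrightarrow> z + y *s w \<in> T"
          using inT by (force simp: open_contains_ball)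
        show ?thesis
        proof (intro exI conjI allI impI)
          show "0 < e" by fact
          show "line_d2 (\<lambda>\<xi>. \<rho> (z + \<xi> *s w) powr \<eta>) \<zeta> 1 (d2 (\<lambda>z. \<rho> z powr \<eta>) (z + \<zeta> *s w) w w)"
            using line_d2_C2[OF T C2' inT, of 1] by simp
          show "line_d2 (\<lambda>\<xi>. \<rho> (z + \<xi> *s w) powr \<eta>) \<zeta> \<i> (d2 (\<lambda>z. \<rho> z powr \<eta>) (z + \<zeta> *s w) (\<i> *s w) (\<i> *s w))"
            using line_d2_C2[OF T C2' inT, of \<i>] by simp
          show "0 \<le> d2 (\<lambda>z. \<rho> z powr \<eta>) (z + \<zeta> *s w) w w + d2 (\<lambda>z. \<rho> z powr \<eta>) (z + \<zeta> *s w) (\<i> *s w) (\<i> *s w)"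
            by (rule strictly_psh_levi_nonneg[OF T psh' inT])
          show "\<rho> (z + \<zeta> *s w) powr \<eta> = \<phi> (z + \<zeta> *s w)" using inT by (simp add: T_def \<phi>_def)
          show "\<rho> (z + y *s w) powr \<eta> \<le> \<phi> (z + y *s w)" if "dist \<zeta> y < e" for y
            using e(2)[OF that] by (simp add: T_def \<phi>_def)
        qed
      qed
      from lower_test_mean_value[OF contf this]
      show "\<phi> z \<le> 1 / (2 * pi) * integral {0..2 * pi} (\<lambda>t. \<phi> (z + cis t *s w))" by simp
    qed
    have "cont_plurisubharmonic_on (\<lambda>z. 1 / (A - \<phi> z)) B"
      unfolding cont_plurisubharmonic_on_def
    proof (intro conjI allI impI)
      show "continuous_on B (\<lambda>z. 1 / (A - \<phi> z))"
        using \<phi>A cont\<phi> BV continuous_on_subset by (intro continuous_intros) force+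
      fix z w assume disc: "\<forall>\<zeta>. cmod \<zeta> \<le> 1 \<longrightarrow> z + \<zeta> *s w \<in> B"
      show "1 / (A - \<phi> z) \<le> 1 / (2 * pi) * integral {0..2 * pi} (\<lambda>t. 1 / (A - \<phi> (z + cis t *s w)))"
        using mean_reciprocal_gap[OF contf[OF disc], of A] submean[OF disc] \<phi>A disc by simp
    qed
    moreover have "compact (closure {z\<in>B. 1 / (A - \<phi> z) < c}) \<and> closure {z\<in>B. 1 / (A - \<phi> z) < c} \<subseteq> B" for c
    proof -
      \<comment> \<open>In product form the condition makes sense on the closed set
        \<open>K\<close>: where \<open>\<rho> = \<epsilon>\<close> the product is 0 and the
        inequality fails, so the compact \<open>L\<close> avoids the boundary of
        \<open>B\<close>.\<close>
      define L where "L = {z\<in>K. 1 \<le> (A - \<phi> z) * c}"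
      have KV: "K \<subseteq> V" using V'(4) by (auto simp: K_def)
      have "closed L"
        unfolding L_def using KV cont\<phi> continuous_on_subset K compact_imp_closed
        by (intro continuous_on_closed_Collect_le continuous_intros) auto
      then have L: "compact L"
        using K by (metis (no_types, lifting) L_def compact_eq_bounded_closed bounded_subset mem_Collect_eq subsetI)
      have "L \<subseteq> B"
      proof
        fix z assume z: "z \<in> L"
        then have "\<phi> z \<noteq> A" by (auto simp: L_def)
        then have "\<rho> z \<noteq> \<epsilon>" using \<epsilon> by (auto simp: \<phi>_def A_def)
        then show "z \<in> B" using z by (auto simp: L_def B_def K_def)
      qed
      moreover have "{z\<in>B. 1 / (A - \<phi> z) < c} \<subseteq> L"
      proof
        fix z assume z: "z \<in> {z\<in>B. 1 / (A - \<phi> z) < c}"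
        then have "0 < A - \<phi> z" "1 / (A - \<phi> z) < c" using \<phi>A by auto
        then have "1 \<le> (A - \<phi> z) * c" by (simp add: field_simps)
        then show "z \<in> L" using z BV by (auto simp: L_def)
      qed
      ultimately show ?thesis
        using L closure_minimal[of _ L] compact_imp_closed[OF L]
        by (metis (no_types, lifting) closed_closure compact_Int_closed inf.absorb_iff2 subset_trans)
    qed
    ultimately show ?thesis
      unfolding pseudoconvex_def using openB by (fold B_def) blast
  qed
  \<comment> \<open>The cut requires \<open>\<epsilon> > 0\<close>; at level 0 the sublevel set is
    \<open>D\<close> itself.\<close>
  moreover have "pseudoconvex {z\<in>V'. \<rho> z < 0}"
    using D(3) defV' by (simp add: defining_function_def)
  ultimately have "\<forall>\<epsilon>. 0 \<le> \<epsilon> \<and> \<epsilon> < e1 \<longrightarrow> pseudoconvex {z\<in>V'. \<rho> z < \<epsilon>}"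
    by (metis order_le_less)
  then show ?thesis
    unfolding strong_stein_nbhd_basis_def using defV' e1(1) by blast
qed

section \<open>From pseudoconvexity to the Levi condition\<close>

text \<open>The function \<open>N |w|\<^sup>2 - |\<zeta>|\<^sup>2\<close> with \<open>w = \<tau> + a \<zeta>\<^sup>2 + \<delta>\<close> cannot touch
  \<^term>\<open>u\<close> from above: along the affine line through the point of contact that is tangent to the
  parabola \<open>w = const\<close> it is strictly superharmonic.\<close>

lemma psh_no_interior_max:
  fixes u :: "complex^'n::finite \<Rightarrow> real" and a d :: complex
  defines "w \<equiv> \<lambda>\<zeta> \<tau>. \<tau> + a * \<zeta>\<^sup>2 + d"
  assumes psh: "cont_plurisubharmonic_on u D"
    and region: "\<And>\<zeta> \<tau>. cmod \<zeta> \<le> r \<Longrightarrow> cmod (w \<zeta> \<tau>) \<le> \<sigma> \<Longrightarrow> p + \<zeta> *s t + \<tau> *s \<nu> \<in> D"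
    and max: "\<And>\<zeta> \<tau>. cmod \<zeta> \<le> r \<Longrightarrow> cmod (w \<zeta> \<tau>) \<le> \<sigma> \<Longrightarrow>
      u (p + \<zeta> *s t + \<tau> *s \<nu>) - N * (cmod (w \<zeta> \<tau>))\<^sup>2 + (cmod \<zeta>)\<^sup>2
      \<le> u (p + \<zeta>\<^sub>1 *s t + \<tau>\<^sub>1 *s \<nu>) - N * (cmod (w \<zeta>\<^sub>1 \<tau>\<^sub>1))\<^sup>2 + (cmod \<zeta>\<^sub>1)\<^sup>2"
    and int: "cmod \<zeta>\<^sub>1 < r" "cmod (w \<zeta>\<^sub>1 \<tau>\<^sub>1) < \<sigma>"
  shows False
proof -
  define z where "z = p + \<zeta>\<^sub>1 *s t + \<tau>\<^sub>1 *s \<nu>"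
  define w1 where "w1 = w \<zeta>\<^sub>1 \<tau>\<^sub>1"
  have l1: "((\<lambda>s. cmod a * s\<^sup>2) \<longlongrightarrow> cmod a * 0\<^sup>2) (at_right 0)"
    and l2: "((\<lambda>s. \<bar>N\<bar> * (cmod a)\<^sup>2 * s\<^sup>2) \<longlongrightarrow> \<bar>N\<bar> * (cmod a)\<^sup>2 * 0\<^sup>2) (at_right 0)" by (intro tendsto_intros)+
  have l3: "((\<lambda>s. s) \<longlongrightarrow> (0::real)) (at_right 0)" by (rule tendsto_ident_at)
  \<comment> \<open>The radius \<open>s\<close> keeps the test disc inside the tube and makes the
    fourth-order gain \<open>N |a|\<^sup>2 s\<^sup>4\<close> smaller than the loss
    \<open>s\<^sup>2\<close>.\<close>
  have "\<forall>\<^sub>F s in at_right 0. (s::real) > 0 \<and> s < r - cmod \<zeta>\<^sub>1 \<and> cmod a * s\<^sup>2 < \<sigma> - cmod w1 \<and> \<bar>N\<bar> * (cmod a)\<^sup>2 * s\<^sup>2 < 1"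
    using int order_tendstoD(2)[OF l1, of "\<sigma> - cmod w1"] order_tendstoD(2)[OF l2, of 1]
      order_tendstoD(2)[OF l3, of "r - cmod \<zeta>\<^sub>1"]
    by (intro eventually_conj eventually_at_right_less) (simp_all add: w1_def)
  then obtain s where s: "0 < s" "s < r - cmod \<zeta>\<^sub>1" "cmod a * s\<^sup>2 < \<sigma> - cmod w1" "\<bar>N\<bar> * (cmod a)\<^sup>2 * s\<^sup>2 < 1"
    using eventually_happens'[of "at_right (0::real)"] by force
  \<comment> \<open>Moving \<open>\<zeta>\<close> by \<open>s x\<close>, the shift of
    \<open>\<tau>\<close> by \<open>- 2 a \<zeta>\<^sub>1 s x\<close> cancels the first-order change
    of \<open>a \<zeta>\<^sup>2\<close>, so along this affine disc \<open>w\<close> changes by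
    \<open>a s\<^sup>2 x\<^sup>2\<close> only.\<close>
  define W where "W = of_real s *s (t - (2 * a * \<zeta>\<^sub>1) *s \<nu>)"
  define Z where "Z = (\<lambda>x. \<zeta>\<^sub>1 + of_real s * x)"
  define T where "T = (\<lambda>x. \<tau>\<^sub>1 - 2 * a * \<zeta>\<^sub>1 * of_real s * x)"
  have line: "z + x *s W = p + Z x *s t + T x *s \<nu>" for x
    by (simp add: z_def W_def Z_def T_def vec_eq_iff algebra_simps)
  have wline: "w (Z x) (T x) = w1 + a * of_real (s\<^sup>2) * x\<^sup>2" for x
    by (simp add: w_def w1_def Z_def T_def power2_eq_square algebra_simps)
  have Zr: "cmod (Z x) \<le> r" if "cmod x \<le> 1" for x
  proof -
    have "cmod (Z x) \<le> cmod \<zeta>\<^sub>1 + s * cmod x"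
      using norm_triangle_ineq[of \<zeta>\<^sub>1 "of_real s * x"] s(1) by (simp add: Z_def norm_mult)
    also have "s * cmod x \<le> s" using s(1) that by (simp add: mult_left_le)
    finally show ?thesis using s(2) by simp
  qed
  have Tr: "cmod (w (Z x) (T x)) \<le> \<sigma>" if "cmod x \<le> 1" for x
  proof -
    have "cmod (w (Z x) (T x)) \<le> cmod w1 + cmod a * s\<^sup>2 * (cmod x)\<^sup>2"
      unfolding wline using norm_triangle_ineq[of w1 "a * of_real (s\<^sup>2) * x\<^sup>2"]
      by (simp add: norm_mult norm_power)
    also have "cmod a * s\<^sup>2 * (cmod x)\<^sup>2 \<le> cmod a * s\<^sup>2"
      using that by (simp add: mult_left_le power_le_one)
    finally show ?thesis using s(3) by simp
  qed
  have disc: "z + x *s W \<in> D" if "cmod x \<le> 1" for x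
    unfolding line using that by (intro region Zr Tr)
  \<comment> \<open>\<open>Q\<close> collects the cross terms from expanding both squared moduli on
    the circle. It vanishes at 0, so its real part has mean zero.\<close>
  define Q where "Q = [:0, - of_real (2 * s) * cnj \<zeta>\<^sub>1, of_real (2 * N * s\<^sup>2) * cnj w1 * a:]"
  have bound: "u (z + cis \<theta> *s W) \<le> (u z + N * (cmod a)\<^sup>2 * s^4 - s\<^sup>2) + Re (poly Q (cis \<theta>))" for \<theta>
  proof -
    have "u (z + cis \<theta> *s W) \<le> u z - N * (cmod w1)\<^sup>2 + (cmod \<zeta>\<^sub>1)\<^sup>2
        + N * (cmod (w (Z (cis \<theta>)) (T (cis \<theta>))))\<^sup>2 - (cmod (Z (cis \<theta>)))\<^sup>2"
      using max[OF Zr Tr, of "cis \<theta>"] unfolding line z_def[symmetric] w1_def by simp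
    moreover have sq: "(cmod (x + y))\<^sup>2 = (cmod x)\<^sup>2 + (cmod y)\<^sup>2 + 2 * Re (cnj x * y)" for x y
      unfolding cmod_power2 by (simp add: power2_eq_square algebra_simps)
    have "(cmod (w (Z (cis \<theta>)) (T (cis \<theta>))))\<^sup>2 = (cmod w1)\<^sup>2 + (cmod a)\<^sup>2 * s^4
        + 2 * Re (cnj w1 * (a * of_real (s\<^sup>2) * (cis \<theta>)\<^sup>2))"
      unfolding wline sq by (simp add: norm_mult norm_power power_mult_distrib flip: power_mult)
    moreover have "(cmod (Z (cis \<theta>)))\<^sup>2 = (cmod \<zeta>\<^sub>1)\<^sup>2 + s\<^sup>2 + 2 * Re (cnj \<zeta>\<^sub>1 * (of_real s * cis \<theta>))"
      unfolding Z_def sq by (simp add: norm_mult)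
    moreover have "Re (poly Q (cis \<theta>)) = N * (2 * Re (cnj w1 * (a * of_real (s\<^sup>2) * (cis \<theta>)\<^sup>2)))
        - 2 * Re (cnj \<zeta>\<^sub>1 * (of_real s * cis \<theta>))"
      unfolding Q_def power2_eq_square by (simp add: algebra_simps)
    ultimately show ?thesis by (simp add: algebra_simps)
  qed
  have contu: "continuous_on D u" using psh by (simp add: cont_plurisubharmonic_on_def)
  have "continuous_on {0..2*pi} (\<lambda>\<theta>. u (z + cis \<theta> *s W))"
    by (rule continuous_on_compose2[OF contu]) (auto intro!: continuous_intros disc)
  then have i: "(\<lambda>\<theta>. u (z + cis \<theta> *s W)) integrable_on {0..2*pi}"
    by (rule integrable_continuous_real)
  have "((\<lambda>\<theta>. (u z + N * (cmod a)\<^sup>2 * s^4 - s\<^sup>2) + Re (poly Q (cis \<theta>))) has_integral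
     2 * pi * (u z + N * (cmod a)\<^sup>2 * s^4 - s\<^sup>2) + 2 * pi * Re (poly Q 0)) {0..2*pi}"
    using has_integral_const_real[of "u z + N * (cmod a)\<^sup>2 * s^4 - s\<^sup>2" 0 "2*pi"]
    by (intro has_integral_add has_integral_Re_poly_circle) simp
  from has_integral_le[OF integrable_integral[OF i] this bound]
  have "integral {0..2*pi} (\<lambda>\<theta>. u (z + cis \<theta> *s W)) \<le> 2 * pi * (u z + N * (cmod a)\<^sup>2 * s^4 - s\<^sup>2)"
    by (simp add: Q_def)
  then have "1 / (2 * pi) * integral {0..2*pi} (\<lambda>\<theta>. u (z + cis \<theta> *s W)) \<le> u z + N * (cmod a)\<^sup>2 * s^4 - s\<^sup>2"
    by (simp add: field_simps)
  moreover have "u z \<le> 1 / (2 * pi) * integral {0..2 * pi} (\<lambda>\<theta>. u (z + cis \<theta> *s W))"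
    using psh disc by (simp add: cont_plurisubharmonic_on_def)
  moreover have "N * (cmod a)\<^sup>2 * s^4 < s\<^sup>2"
  proof -
    have "N * ((cmod a)\<^sup>2 * s^4) \<le> \<bar>N\<bar> * ((cmod a)\<^sup>2 * s^4)"
      by (intro mult_right_mono) auto
    then have "N * (cmod a)\<^sup>2 * s^4 \<le> (\<bar>N\<bar> * (cmod a)\<^sup>2 * s\<^sup>2) * s\<^sup>2"
      by (simp add: power2_eq_square power4_eq_xxxx mult.assoc)
    also have "\<dots> < 1 * s\<^sup>2" using s(1,4) by (intro mult_strict_right_mono) auto
    finally show ?thesis by simp
  qed
  ultimately show False by simp
qed

section \<open>Taylor expansion in complex tangential and normal directions\<close>

lemma linear_complex_smult:
  fixes f :: "complex^'n::finite \<Rightarrow> real"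
  assumes "linear f"
  shows "f (c *s v) = Re c * f v + Im c * f (\<i> *s v)"
proof -
  have "c *s v = Re c *\<^sub>R v + Im c *\<^sub>R (\<i> *s v)"
    by (simp add: vec_eq_iff complex_eq_iff)
  then show ?thesis using assms by (simp add: linear_add linear_scale)
qed

lemma d2_smult:
  fixes \<rho> :: "complex^'n::finite \<Rightarrow> real"
  assumes "open S" "Ck_on 2 \<rho> S" "x \<in> S"
  shows "d2 \<rho> x (c *s v) (c *s v) = (Re c)\<^sup>2 * d2 \<rho> x v v
    + Re c * Im c * (d2 \<rho> x v (\<i> *s v) + d2 \<rho> x (\<i> *s v) v) + (Im c)\<^sup>2 * d2 \<rho> x (\<i> *s v) (\<i> *s v)"
  by (simp add: linear_complex_smult[OF d2_linear1[OF assms], where c = c and v = v]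
      linear_complex_smult[OF d2_linear2[OF assms], where c = c and v = v] power2_eq_square algebra_simps)

text \<open>The path first moves tangentially with \<open>\<tau> = 0\<close>, where a second-order
  expansion has no linear term, and then in the normal direction with \<open>\<zeta>\<close> fixed,
  where a first-order estimate suffices. Mixed second-order terms disappear in
  \<open>\<kappa> * cmod \<tau>\<close>, since the gradient is nearly constant close to
  \<open>p\<close>.\<close>

lemma Taylor_upper_bound:
  fixes \<rho> :: "complex^'n::finite \<Rightarrow> real"
  assumes S: "open S" "Ck_on 2 \<rho> S" "p \<in> S"
    and t: "frechet_derivative \<rho> (at p) t = 0" "frechet_derivative \<rho> (at p) (\<i> *s t) = 0"
    and \<nu>: "frechet_derivative \<rho> (at p) \<nu> = 1" "frechet_derivative \<rho> (at p) (\<i> *s \<nu>) = 0"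
    and "0 < \<kappa>"
  obtains r where "0 < r"
    "\<And>\<zeta> \<tau>. cmod \<zeta> \<le> r \<Longrightarrow> cmod \<tau> \<le> r \<Longrightarrow> p + \<zeta> *s t + \<tau> *s \<nu> \<in> S \<and>
      \<rho> (p + \<zeta> *s t + \<tau> *s \<nu>) - \<rho> p \<le> Re \<tau> + \<kappa> * cmod \<tau> + d2 \<rho> p (\<zeta> *s t) (\<zeta> *s t) / 2 + \<kappa> * (cmod \<zeta>)\<^sup>2"
proof -
  \<comment> \<open>Half of \<open>\<kappa>\<close>, because the real and imaginary parts of
    \<open>\<tau>\<close> each contribute an error \<open>k * cmod \<tau>\<close>.\<close>
  define k where "k = \<kappa> / 2"
  have k: "0 < k" using \<open>0 < \<kappa>\<close> by (simp add: k_def)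
  let ?D = "\<lambda>x v. frechet_derivative \<rho> (at x) v" and ?j = "\<i> *s t"
  have near: "\<forall>\<^sub>F x in nhds p. \<bar>f x - f p\<bar> < k" if "continuous_on S f" for f :: "complex^'n \<Rightarrow> real"
  proof -
    have "(f \<longlongrightarrow> f p) (nhds p)"
      using that S(1,3) by (simp add: continuous_on_eq_continuous_at isCont_def tendsto_nhds_iff)
    then show ?thesis using k by (auto dest!: tendstoD simp: dist_real_def)
  qed
  have "\<forall>\<^sub>F x in nhds p. x \<in> S \<and> \<bar>?D x \<nu> - ?D p \<nu>\<bar> < k \<and> \<bar>?D x (\<i> *s \<nu>) - ?D p (\<i> *s \<nu>)\<bar> < k \<and>
     \<bar>d2 \<rho> x t t - d2 \<rho> p t t\<bar> < k \<and> \<bar>d2 \<rho> x t ?j - d2 \<rho> p t ?j\<bar> < k \<and>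
     \<bar>d2 \<rho> x ?j t - d2 \<rho> p ?j t\<bar> < k \<and> \<bar>d2 \<rho> x ?j ?j - d2 \<rho> p ?j ?j\<bar> < k"
    using S C2_continuous_derivative[OF S(2)]
    by (intro eventually_conj near eventually_nhds_in_open) auto
  then obtain e where e: "0 < e" and
    E: "\<And>x. dist x p < e \<Longrightarrow> x \<in> S \<and> \<bar>?D x \<nu> - ?D p \<nu>\<bar> < k \<and> \<bar>?D x (\<i> *s \<nu>) - ?D p (\<i> *s \<nu>)\<bar> < k \<and>
     \<bar>d2 \<rho> x t t - d2 \<rho> p t t\<bar> < k \<and> \<bar>d2 \<rho> x t ?j - d2 \<rho> p t ?j\<bar> < k \<and>
     \<bar>d2 \<rho> x ?j t - d2 \<rho> p ?j t\<bar> < k \<and> \<bar>d2 \<rho> x ?j ?j - d2 \<rho> p ?j ?j\<bar> < k"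
    unfolding eventually_nhds_metric by blast
  define F where "F = (\<lambda>\<zeta> \<tau>. p + \<zeta> *s t + \<tau> *s \<nu>)"
  have "open ((\<lambda>(\<zeta>, \<tau>). F \<zeta> \<tau>) -` ball p e)"
  proof -
    have "continuous_on UNIV (\<lambda>(\<zeta>, \<tau>). F \<zeta> \<tau>)"
      unfolding F_def split_def by (intro continuous_intros)
    then show ?thesis using continuous_on_open_vimage[OF open_UNIV] open_ball by fastforce
  qed
  moreover have "(0, 0) \<in> (\<lambda>(\<zeta>, \<tau>). F \<zeta> \<tau>) -` ball p e" using e by (simp add: F_def)
  ultimately obtain d where d: "0 < d" "ball (0, 0) d \<subseteq> (\<lambda>(\<zeta>, \<tau>). F \<zeta> \<tau>) -` ball p e"
    by (rule openE)
  define r where "r = d / 3"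
  have r: "0 < r" using d by (simp add: r_def)
  have near: "dist (F \<zeta> \<tau>) p < e" if "cmod \<zeta> \<le> r" "cmod \<tau> \<le> r" for \<zeta> \<tau>
  proof -
    have "norm (\<zeta>, \<tau>) \<le> cmod \<zeta> + cmod \<tau>" by (rule norm_Pair_le)
    then have "(\<zeta>, \<tau>) \<in> ball (0, 0) d"
      using that d(1) by (simp add: mem_ball_0 r_def flip: zero_prod_def)
    then have "(\<zeta>, \<tau>) \<in> (\<lambda>(\<zeta>, \<tau>). F \<zeta> \<tau>) -` ball p e" using d(2) by blast
    then show ?thesis by (simp add: dist_commute)
  qed
  note inS = E[OF near, THEN conjunct1]
  show thesis
  proof (rule that[OF r], intro conjI)
    fix \<zeta> \<tau> :: complex assume \<zeta>: "cmod \<zeta> \<le> r" and \<tau>: "cmod \<tau> \<le> r"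
    show "p + \<zeta> *s t + \<tau> *s \<nu> \<in> S" using inS[OF \<zeta> \<tau>] by (simp add: F_def)
    have small: "cmod (of_real s * c) \<le> r" if "cmod c \<le> r" "0 \<le> s" "s \<le> 1" for s c
      using that mult_left_le_one_le[of "cmod c" s] by (simp add: norm_mult)
    have normal: "\<rho> (F \<zeta> \<tau>) - \<rho> (F \<zeta> 0) \<le> Re \<tau> + \<kappa> * cmod \<tau>"
    proof -
      have eq: "F \<zeta> (of_real s * \<tau>) = F \<zeta> 0 + s *\<^sub>R (\<tau> *s \<nu>)" for s
        by (simp add: F_def scaleR_smult_vec vec_eq_iff algebra_simps)
      have "((\<lambda>s. \<rho> (F \<zeta> 0 + s *\<^sub>R (\<tau> *s \<nu>))) has_real_derivative ?D (F \<zeta> (of_real s * \<tau>)) (\<tau> *s \<nu>)) (at s)"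
        if "0 \<le> s" "s \<le> 1" for s
        using C2_line(1)[OF S(1,2), of "F \<zeta> 0" s "\<tau> *s \<nu>"] inS[OF \<zeta> small[OF \<tau> that]] by (simp add: eq)
      then obtain s where s: "0 < s" "s < 1"
        "\<rho> (F \<zeta> 0 + 1 *\<^sub>R (\<tau> *s \<nu>)) - \<rho> (F \<zeta> 0 + 0 *\<^sub>R (\<tau> *s \<nu>)) = (1 - 0) * ?D (F \<zeta> (of_real s * \<tau>)) (\<tau> *s \<nu>)"
        using MVT2[of 0 1 "\<lambda>s. \<rho> (F \<zeta> 0 + s *\<^sub>R (\<tau> *s \<nu>))" "\<lambda>s. ?D (F \<zeta> (of_real s * \<tau>)) (\<tau> *s \<nu>)"] by auto
      let ?x = "F \<zeta> (of_real s * \<tau>)"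
      have x: "?x \<in> S" "\<bar>?D ?x \<nu> - 1\<bar> < k" "\<bar>?D ?x (\<i> *s \<nu>)\<bar> < k"
        using E[OF near[OF \<zeta> small[OF \<tau>, of s]]] s \<nu> by auto
      have "?D ?x (\<tau> *s \<nu>) - Re \<tau> = Re \<tau> * (?D ?x \<nu> - 1) + Im \<tau> * ?D ?x (\<i> *s \<nu>)"
        unfolding linear_complex_smult[OF C2_linear[OF S(1,2) x(1)], where c = \<tau> and v = \<nu>]
        by (simp add: algebra_simps)
      also have "\<dots> \<le> \<bar>Re \<tau>\<bar> * \<bar>?D ?x \<nu> - 1\<bar> + \<bar>Im \<tau>\<bar> * \<bar>?D ?x (\<i> *s \<nu>)\<bar>"
        by (intro add_mono) (simp_all flip: abs_mult)
      also have "\<dots> \<le> cmod \<tau> * k + cmod \<tau> * k"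
        using x abs_Re_le_cmod[of \<tau>] abs_Im_le_cmod[of \<tau>] by (intro add_mono mult_mono) auto
      finally show ?thesis using s(3) eq[of 1] by (simp add: k_def)
    qed
    have tangential: "\<rho> (F \<zeta> 0) - \<rho> p \<le> d2 \<rho> p (\<zeta> *s t) (\<zeta> *s t) / 2 + \<kappa> * (cmod \<zeta>)\<^sup>2"
    proof -
      let ?v = "\<zeta> *s t"
      have eq: "F (of_real s * \<zeta>) 0 = p + s *\<^sub>R ?v" for s
        by (simp add: F_def scaleR_smult_vec vec_eq_iff algebra_simps)
      have line_S: "p + s *\<^sub>R ?v \<in> S" if "0 \<le> s" "s \<le> 1" for s
        using inS[OF small[OF \<zeta> that], of 0] r by (simp add: eq)
      define diff where "diff = (\<lambda>m::nat. if m = 0 then (\<lambda>s. \<rho> (p + s *\<^sub>R ?v))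
         else if m = 1 then (\<lambda>s. ?D (p + s *\<^sub>R ?v) ?v) else (\<lambda>s. d2 \<rho> (p + s *\<^sub>R ?v) ?v ?v))"
      have "\<forall>m s. m < 2 \<and> 0 \<le> s \<and> s \<le> 1 \<longrightarrow> (diff m has_real_derivative diff (Suc m) s) (at s)"
        using C2_line[OF S(1,2) line_S] by (auto simp: diff_def less_2_cases_iff)
      then obtain s where s: "0 < s" "s < 1"
        "diff 0 1 = (\<Sum>m<2. diff m 0 / fact m * 1 ^ m) + diff 2 s / fact 2 * 1 ^ 2"
        using Maclaurin[of 1 2 diff "diff 0"] by auto
      have "?D p ?v = 0"
        using t by (simp add: linear_complex_smult[OF C2_linear[OF S], where c = \<zeta> and v = t])
      then have taylor: "\<rho> (F \<zeta> 0) = \<rho> p + d2 \<rho> (p + s *\<^sub>R ?v) ?v ?v / 2"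
        using s(3) eq[of 1] by (simp add: diff_def numeral_2_eq_2)
      let ?x = "p + s *\<^sub>R ?v"
      have x: "?x \<in> S" "\<bar>d2 \<rho> ?x t t - d2 \<rho> p t t\<bar> < k" "\<bar>d2 \<rho> ?x t ?j - d2 \<rho> p t ?j\<bar> < k"
        "\<bar>d2 \<rho> ?x ?j t - d2 \<rho> p ?j t\<bar> < k" "\<bar>d2 \<rho> ?x ?j ?j - d2 \<rho> p ?j ?j\<bar> < k"
        using E[OF near[OF small[OF \<zeta>, of s], of 0]] s r by (auto simp: eq)
      have "d2 \<rho> ?x ?v ?v - d2 \<rho> p ?v ?v = (Re \<zeta>)\<^sup>2 * (d2 \<rho> ?x t t - d2 \<rho> p t t)
          + (Re \<zeta> * Im \<zeta>) * ((d2 \<rho> ?x t ?j - d2 \<rho> p t ?j) + (d2 \<rho> ?x ?j t - d2 \<rho> p ?j t))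
          + (Im \<zeta>)\<^sup>2 * (d2 \<rho> ?x ?j ?j - d2 \<rho> p ?j ?j)"
        unfolding d2_smult[OF S(1,2) x(1), of \<zeta> t] d2_smult[OF S, of \<zeta> t] by (simp add: algebra_simps)
      also have "\<dots> \<le> (Re \<zeta>)\<^sup>2 * k + \<bar>Re \<zeta> * Im \<zeta>\<bar> * (2 * k) + (Im \<zeta>)\<^sup>2 * k"
      proof (intro add_mono mult_left_mono)
        show "Re \<zeta> * Im \<zeta> * (d2 \<rho> ?x t ?j - d2 \<rho> p t ?j + (d2 \<rho> ?x ?j t - d2 \<rho> p ?j t)) \<le> \<bar>Re \<zeta> * Im \<zeta>\<bar> * (2 * k)"
          by (rule order_trans[OF abs_ge_self], subst abs_mult, rule mult_left_mono) (use x in auto)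
      qed (use x in auto)
      also have "\<dots> \<le> 2 * k * ((Re \<zeta>)\<^sup>2 + (Im \<zeta>)\<^sup>2)"
      proof -
        have "2 * \<bar>Re \<zeta> * Im \<zeta>\<bar> \<le> (Re \<zeta>)\<^sup>2 + (Im \<zeta>)\<^sup>2"
          using sum_squares_bound[of "\<bar>Re \<zeta>\<bar>" "\<bar>Im \<zeta>\<bar>"] by (simp add: abs_mult)
        then have "k * (2 * \<bar>Re \<zeta> * Im \<zeta>\<bar>) \<le> k * ((Re \<zeta>)\<^sup>2 + (Im \<zeta>)\<^sup>2)" using k by simp
        then show ?thesis by (simp add: algebra_simps)
      qed
      finally have "d2 \<rho> ?x ?v ?v \<le> d2 \<rho> p ?v ?v + \<kappa> * (cmod \<zeta>)\<^sup>2" by (simp add: k_def cmod_power2)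
      moreover have "0 \<le> \<kappa> * (cmod \<zeta>)\<^sup>2" using \<open>0 < \<kappa>\<close> by simp
      ultimately show ?thesis using taylor by simp
    qed
    show "\<rho> (p + \<zeta> *s t + \<tau> *s \<nu>) - \<rho> p \<le> Re \<tau> + \<kappa> * cmod \<tau> + d2 \<rho> p (\<zeta> *s t) (\<zeta> *s t) / 2 + \<kappa> * (cmod \<zeta>)\<^sup>2"
      using normal tangential by (simp add: F_def)
  qed
qed

lemma normal_vector_exists:
  fixes f :: "complex^'n::finite \<Rightarrow> real"
  assumes "linear f" "f \<noteq> (\<lambda>_. 0)"
  obtains \<nu> where "f \<nu> = 1" "f (\<i> *s \<nu>) = 0"
proof -
  obtain v where v: "f v \<noteq> 0" using assms(2) by blast
  define \<alpha> \<beta> where "\<alpha> = f v" and "\<beta> = f (\<i> *s v)"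
  define q where "q = \<alpha>\<^sup>2 + \<beta>\<^sup>2"
  have q: "q \<noteq> 0" using v by (simp add: q_def \<alpha>_def sum_power2_eq_zero_iff)
  \<comment> \<open>The complex linear functional \<open>v \<mapsto> f v - \<i> f (\<i> v)\<close>
    takes the value \<open>\<alpha> - \<i> \<beta>\<close> at \<open>v\<close>; \<open>c\<close> is
    the inverse of this number and normalises the value to 1.\<close>
  define c where "c = Complex (\<alpha> / q) (\<beta> / q)"
  have "f (c *s v) = \<alpha> / q * \<alpha> + \<beta> / q * \<beta>"
    unfolding linear_complex_smult[OF assms(1), where c = c and v = v]
    by (simp add: c_def \<alpha>_def \<beta>_def)
  also have "\<dots> = q / q" by (subst (3) q_def) (simp add: power2_eq_square add_divide_distrib)
  also have "\<dots> = 1" using q by simp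
  finally have 1: "f (c *s v) = 1" .
  have "\<i> *s (c *s v) = (\<i> * c) *s v" by simp
  have "f (\<i> *s (c *s v)) = - (\<beta> / q) * \<alpha> + \<alpha> / q * \<beta>"
    unfolding \<open>\<i> *s (c *s v) = (\<i> * c) *s v\<close> linear_complex_smult[OF assms(1), where c = "\<i> * c" and v = v]
    by (simp add: c_def \<alpha>_def \<beta>_def)
  then show thesis using that[OF 1] by simp
qed

lemma pseudoconvex_levi_nonneg:
  fixes \<rho> :: "complex^'n::finite \<Rightarrow> real"
  assumes S: "open S" "Ck_on 2 \<rho> S" "p \<in> S"
    and D: "pseudoconvex D" "D \<inter> S = {x\<in>S. \<rho> x < \<rho> p}"
    and nz: "frechet_derivative \<rho> (at p) \<noteq> (\<lambda>_. 0)"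
    and t: "frechet_derivative \<rho> (at p) t = 0" "frechet_derivative \<rho> (at p) (\<i> *s t) = 0"
  shows "0 \<le> d2 \<rho> p t t + d2 \<rho> p (\<i> *s t) (\<i> *s t)"
proof (rule ccontr)
  define \<mu> where "\<mu> = - (d2 \<rho> p t t + d2 \<rho> p (\<i> *s t) (\<i> *s t)) / 4"
  assume "\<not> 0 \<le> d2 \<rho> p t t + d2 \<rho> p (\<i> *s t) (\<i> *s t)"
  then have \<mu>: "0 < \<mu>" by (simp add: \<mu>_def)
  obtain \<nu> where \<nu>: "frechet_derivative \<rho> (at p) \<nu> = 1" "frechet_derivative \<rho> (at p) (\<i> *s \<nu>) = 0"
    using normal_vector_exists[OF C2_linear[OF S] nz] .
  \<comment> \<open>The real quadratic form on the tangent line splits into a harmonic part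
    \<open>Re (a * \<zeta>\<^sup>2)\<close> and \<open>- \<mu> |\<zeta>|\<^sup>2\<close>. Bending
    the disc by \<open>\<tau> = - a * \<zeta>\<^sup>2\<close> cancels the harmonic part.\<close>
  define a where "a = Complex ((d2 \<rho> p t t - d2 \<rho> p (\<i> *s t) (\<i> *s t)) / 4)
     (- (d2 \<rho> p t (\<i> *s t) + d2 \<rho> p (\<i> *s t) t) / 4)"
  have quad: "d2 \<rho> p (\<zeta> *s t) (\<zeta> *s t) / 2 = Re (a * \<zeta>\<^sup>2) - \<mu> * (cmod \<zeta>)\<^sup>2" for \<zeta>
    unfolding d2_smult[OF S, of \<zeta> t] cmod_power2
    by (simp add: a_def \<mu>_def power2_eq_square field_simps)
  \<comment> \<open>The bound \<open>1 / 4\<close> keeps the term linear in \<open>\<delta>\<close>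
    negative; the other one limits the errors quadratic in \<open>\<zeta>\<close> to half of
    \<open>\<mu> |\<zeta>|\<^sup>2\<close>.\<close>
  define \<kappa> where "\<kappa> = min (1 / 4) (\<mu> / (2 * (1 + cmod a)))"
  have ca: "0 < 1 + cmod a" by (simp add: add_pos_nonneg)
  have \<kappa>: "0 < \<kappa>" "\<kappa> \<le> 1 / 4" "\<kappa> * (1 + cmod a) \<le> \<mu> / 2"
  proof -
    show "0 < \<kappa>" using \<mu> ca by (simp add: \<kappa>_def)
    show "\<kappa> \<le> 1 / 4" unfolding \<kappa>_def by (rule min.cobounded1)
    have "\<kappa> * (1 + cmod a) \<le> \<mu> / (2 * (1 + cmod a)) * (1 + cmod a)"
      unfolding \<kappa>_def using ca by (intro mult_right_mono min.cobounded2) simp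
    also have "\<dots> = \<mu> / 2"
      using ca nonzero_mult_divide_mult_cancel_right[of "1 + cmod a" \<mu> 2] by simp
    finally show "\<kappa> * (1 + cmod a) \<le> \<mu> / 2" .
  qed
  define F where "F = (\<lambda>\<zeta> \<tau>. p + \<zeta> *s t + \<tau> *s \<nu>)"
  obtain r0 where r0: "0 < r0" and FS: "\<And>\<zeta> \<tau>. cmod \<zeta> \<le> r0 \<Longrightarrow> cmod \<tau> \<le> r0 \<Longrightarrow> F \<zeta> \<tau> \<in> S"
    and T: "\<And>\<zeta> \<tau>. cmod \<zeta> \<le> r0 \<Longrightarrow> cmod \<tau> \<le> r0 \<Longrightarrow>
      \<rho> (F \<zeta> \<tau>) - \<rho> p \<le> Re \<tau> + \<kappa> * cmod \<tau> + d2 \<rho> p (\<zeta> *s t) (\<zeta> *s t) / 2 + \<kappa> * (cmod \<zeta>)\<^sup>2"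
    using Taylor_upper_bound[OF S t \<nu> \<kappa>(1)] unfolding F_def by metis
  have contF: "continuous_on X (\<lambda>x. F (fst x) (snd x))" for X
    unfolding F_def by (intro continuous_intros)
  \<comment> \<open>Small enough that \<open>|a| r\<^sup>2 \<le> r0 / 2\<close>, so the bent tubes
    remain where the Taylor bound holds.\<close>
  define r where "r = min r0 1 / (2 * (1 + cmod a))"
  have r: "0 < r" "r \<le> r0" "cmod a * r\<^sup>2 \<le> r0 / 2"
  proof -
    show "0 < r" using r0 ca by (simp add: r_def)
    have "r \<le> min r0 1 / 1" unfolding r_def using r0 by (intro divide_left_mono) (auto intro: add_pos_nonneg)
    then show rr0: "r \<le> r0" by simp
    have half: "x * (y / (2 * x)) = y / 2" if "0 < x" for x y :: real using that by simp
    have "cmod a * r \<le> (1 + cmod a) * r" using \<open>0 < r\<close> by (intro mult_right_mono) auto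
    also have "\<dots> = min r0 1 / 2" unfolding r_def by (rule half[OF ca])
    finally have "cmod a * r \<le> 1 / 2" by simp
    then have "(cmod a * r) * r \<le> 1 / 2 * r0" using rr0 \<open>0 < r\<close> by (intro mult_mono) auto
    then show "cmod a * r\<^sup>2 \<le> r0 / 2" by (simp add: power2_eq_square)
  qed
  \<comment> \<open>The discs \<open>w \<delta> \<zeta> \<tau> = 0\<close> osculate the level set of \<open>\<rho>\<close> through \<open>p\<close>, pushed inwards by \<open>\<delta>\<close>.\<close>
  define w where "w = (\<lambda>(\<delta>::real) \<zeta> \<tau>. \<tau> + a * \<zeta>\<^sup>2 + of_real \<delta>)"
  have \<tau>_bound: "cmod \<tau> \<le> 5 / 4 * \<delta> + cmod a * (cmod \<zeta>)\<^sup>2" if "0 < \<delta>" "cmod (w \<delta> \<zeta> \<tau>) \<le> \<delta> / 4" for \<delta> \<zeta> \<tau>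
  proof -
    have "\<tau> = w \<delta> \<zeta> \<tau> - a * \<zeta>\<^sup>2 - of_real \<delta>" by (simp add: w_def)
    then have "cmod \<tau> \<le> cmod (w \<delta> \<zeta> \<tau>) + cmod (a * \<zeta>\<^sup>2) + cmod (of_real \<delta>)"
      by (metis norm_triangle_ineq4 norm_triangle_le_diff add_right_mono order_trans)
    then show ?thesis using that by (simp add: norm_mult norm_power)
  qed
  have small: "cmod \<zeta> \<le> r0" "cmod \<tau> \<le> r0"
    if "0 < \<delta>" "\<delta> \<le> r0 / 4" "cmod \<zeta> \<le> r" "cmod (w \<delta> \<zeta> \<tau>) \<le> \<delta> / 4" for \<delta> \<zeta> \<tau>
  proof -
    show "cmod \<zeta> \<le> r0" using that r by simp
    have "cmod a * (cmod \<zeta>)\<^sup>2 \<le> cmod a * r\<^sup>2" using that by (intro mult_left_mono power_mono) auto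
    then show "cmod \<tau> \<le> r0" using \<tau>_bound[OF that(1,4)] that(2) r(3) r0 by simp
  qed
  have below: "\<rho> (F \<zeta> \<tau>) - \<rho> p \<le> - \<delta> / 4 - \<mu> / 2 * (cmod \<zeta>)\<^sup>2"
    if "0 < \<delta>" "\<delta> \<le> r0 / 4" "cmod \<zeta> \<le> r" "cmod (w \<delta> \<zeta> \<tau>) \<le> \<delta> / 4" for \<delta> \<zeta> \<tau>
  proof -
    have "\<rho> (F \<zeta> \<tau>) - \<rho> p \<le> Re \<tau> + \<kappa> * cmod \<tau> + Re (a * \<zeta>\<^sup>2) - \<mu> * (cmod \<zeta>)\<^sup>2 + \<kappa> * (cmod \<zeta>)\<^sup>2"
      using T[OF small[OF that]] unfolding quad by simp
    also have "Re \<tau> = Re (w \<delta> \<zeta> \<tau>) - Re (a * \<zeta>\<^sup>2) - \<delta>" by (simp add: w_def)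
    also have "Re (w \<delta> \<zeta> \<tau>) \<le> \<delta> / 4" using complex_Re_le_cmod that(4) order_trans by blast
    also have "\<kappa> * cmod \<tau> \<le> \<kappa> * (5 / 4 * \<delta> + cmod a * (cmod \<zeta>)\<^sup>2)"
      using \<tau>_bound[OF that(1,4)] \<kappa>(1) by simp
    finally have "\<rho> (F \<zeta> \<tau>) - \<rho> p \<le> - 3 / 4 * \<delta> + \<kappa> * (5 / 4 * \<delta>)
        + \<kappa> * (1 + cmod a) * (cmod \<zeta>)\<^sup>2 - \<mu> * (cmod \<zeta>)\<^sup>2"
      by (simp add: algebra_simps)
    also have "\<kappa> * (5 / 4 * \<delta>) \<le> 1 / 4 * (5 / 4 * \<delta>)" using \<kappa>(2) that(1) by (intro mult_right_mono) auto
    also have "\<kappa> * (1 + cmod a) * (cmod \<zeta>)\<^sup>2 \<le> \<mu> / 2 * (cmod \<zeta>)\<^sup>2"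
      using \<kappa>(3) by (intro mult_right_mono) auto
    finally show ?thesis using that(1) by simp
  qed
  have inD: "F \<zeta> \<tau> \<in> D"
    if "0 < \<delta>" "\<delta> \<le> r0 / 4" "cmod \<zeta> \<le> r" "cmod (w \<delta> \<zeta> \<tau>) \<le> \<delta> / 4" for \<delta> \<zeta> \<tau>
  proof -
    have "0 \<le> \<mu> / 2 * (cmod \<zeta>)\<^sup>2" using \<mu> by simp
    then have "\<rho> (F \<zeta> \<tau>) < \<rho> p" using below[OF that] that(1) by linarith
    then show ?thesis using D(2) FS[OF small[OF that]] by blast
  qed
  obtain u where u: "cont_plurisubharmonic_on u D"
    and exh: "\<And>c. closure {z\<in>D. u z < c} \<subseteq> D"
    using D(1) unfolding pseudoconvex_def by blast
  have contu: "continuous_on D u" using u by (simp add: cont_plurisubharmonic_on_def)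
  \<comment> \<open>A compact subset of \<open>D\<close> that contains the side
    \<open>|\<zeta>| = r\<close> of every tube, independently of \<open>\<delta>\<close>. The bound
    \<open>M\<close> for \<open>u\<close> there is thus fixed before \<open>\<delta>\<close> is
    chosen.\<close>
  define K where "K = (\<lambda>x. F (fst x) (snd x)) ` {x \<in> cball 0 r0 \<times> cball 0 r0. \<rho> (F (fst x) (snd x)) \<le> \<rho> p - \<mu> / 2 * r\<^sup>2}"
  have "continuous_on (cball 0 r0 \<times> cball 0 r0) (\<lambda>x. \<rho> (F (fst x) (snd x)))"
    by (rule continuous_on_compose2[OF Ck_on_continuous[OF S(2)] contF]) (auto intro: FS)
  then have "closed {x \<in> cball 0 r0 \<times> cball 0 r0. \<rho> (F (fst x) (snd x)) \<le> \<rho> p - \<mu> / 2 * r\<^sup>2}"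
    by (intro continuous_on_closed_Collect_le continuous_intros closed_Times) auto
  moreover have "bounded {x \<in> cball 0 r0 \<times> cball (0::complex) r0. \<rho> (F (fst x) (snd x)) \<le> \<rho> p - \<mu> / 2 * r\<^sup>2}"
    by (rule bounded_subset[OF bounded_Times[OF bounded_cball bounded_cball]]) auto
  ultimately have K: "compact K"
    unfolding K_def by (intro compact_continuous_image contF) (simp add: compact_eq_bounded_closed)
  have "K \<subseteq> D"
  proof
    fix x assume "x \<in> K"
    then have "x \<in> S" "\<rho> x \<le> \<rho> p - \<mu> / 2 * r\<^sup>2" by (auto simp: K_def intro: FS)
    moreover have "0 < \<mu> / 2 * r\<^sup>2" using \<mu> r(1) by simp
    ultimately show "x \<in> D" using D(2) by force
  qed
  then have "bounded (u ` K)"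
    using K contu continuous_on_subset compact_continuous_image compact_imp_bounded by blast
  then obtain M where M: "\<And>x. x \<in> K \<Longrightarrow> u x \<le> M"
    unfolding bounded_iff by (force simp: abs_le_iff)
  \<comment> \<open>More than the maximised function can reach on the side of a tube, the term
    \<open>|\<zeta>|\<^sup>2\<close> included. Since \<open>p\<close> is not in \<open>D\<close>,
    the exhaustion exceeds \<open>c\<close> near \<open>p\<close>, in particular at the centre of
    the tube once \<open>\<delta>\<close> is small.\<close>
  define c where "c = M + r\<^sup>2 + 1"
  have "p \<notin> D" using D(2) S(3) by blast
  then have "p \<notin> closure {z\<in>D. u z < c}" using exh by blast
  then obtain e where e: "0 < e" "\<And>x. x \<in> D \<Longrightarrow> dist x p < e \<Longrightarrow> c \<le> u x"
    unfolding closure_approachable by force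
  have "((\<lambda>\<delta>. F 0 (- of_real \<delta>)) \<longlongrightarrow> F 0 (- of_real 0)) (at_right 0)"
  proof -
    have "continuous_on UNIV (\<lambda>\<delta>. F 0 (- of_real \<delta>))" unfolding F_def by (intro continuous_intros)
    then have "isCont (\<lambda>\<delta>. F 0 (- of_real \<delta>)) 0" by (simp add: continuous_on_eq_continuous_at)
    then show ?thesis unfolding isCont_def using tendsto_within_subset by blast
  qed
  then have "\<forall>\<^sub>F \<delta> in at_right 0. dist (F 0 (- of_real \<delta>)) p < e"
    using e(1) by (auto dest!: tendstoD simp: F_def)
  moreover have "\<forall>\<^sub>F \<delta> in at_right (0::real). \<delta> < r0 / 4"
    using order_tendstoD(2)[OF tendsto_ident_at, of 0 "r0 / 4"] r0 by simp
  ultimately have "\<forall>\<^sub>F \<delta> in at_right 0. 0 < \<delta> \<and> \<delta> < r0 / 4 \<and> dist (F 0 (- of_real \<delta>)) p < e"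
    by (intro eventually_conj eventually_at_right_less)
  then obtain \<delta> where \<delta>: "0 < \<delta>" "\<delta> \<le> r0 / 4" "dist (F 0 (- of_real \<delta>)) p < e"
    using eventually_happens'[of "at_right (0::real)"] by force
  have w0: "w \<delta> 0 (- of_real \<delta>) = 0" by (simp add: w_def)
  have uc: "c \<le> u (F 0 (- of_real \<delta>))"
    using inD[OF \<delta>(1,2), of 0 "- of_real \<delta>"] e(2)[OF _ \<delta>(3)] r(1) \<delta>(1) by (simp add: w0)
  define R where "R = {x. cmod (fst x) \<le> r \<and> cmod (w \<delta> (fst x) (snd x)) \<le> \<delta> / 4}"
  have contw: "continuous_on X (\<lambda>x. w \<delta> (fst x) (snd x))" for X
    unfolding w_def by (intro continuous_intros)
  have "closed R" unfolding R_def
    by (intro closed_Collect_conj closed_Collect_le continuous_intros contw)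
  moreover have "R \<subseteq> cball 0 r0 \<times> cball 0 r0"
    using small[OF \<delta>(1,2)] by (auto simp: R_def)
  ultimately have R: "compact R"
    using compact_Times[OF compact_cball compact_cball]
    by (metis compact_eq_bounded_closed bounded_subset)
  have R0: "(0, - of_real \<delta>) \<in> R" using r(1) \<delta>(1) by (simp add: R_def w0)
  have contuF: "continuous_on R (\<lambda>x. u (F (fst x) (snd x)))"
    by (rule continuous_on_compose2[OF contu contF]) (use inD[OF \<delta>(1,2)] in \<open>auto simp: R_def\<close>)
  then have "bounded ((\<lambda>x. u (F (fst x) (snd x))) ` R)"
    using R compact_continuous_image compact_imp_bounded by blast
  then obtain m where m: "\<And>x. x \<in> R \<Longrightarrow> u (F (fst x) (snd x)) \<le> m"
    unfolding bounded_iff by (force simp: abs_le_iff)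
  \<comment> \<open>Chosen after \<open>\<delta>\<close> and the bound \<open>m\<close> for
    \<open>u\<close> on the tube, so that the penalty pushes the function below \<open>c\<close>
    where \<open>|w| = \<delta> / 4\<close>. The maximum is then interior, for
    \<open>psh_no_interior_max\<close> puts no bound on \<open>N\<close>.\<close>
  define N where "N = (\<bar>m\<bar> + r\<^sup>2 + \<bar>c\<bar> + 1) / (\<delta> / 4)\<^sup>2"
  define \<Phi> where "\<Phi> = (\<lambda>x. u (F (fst x) (snd x)) - N * (cmod (w \<delta> (fst x) (snd x)))\<^sup>2 + (cmod (fst x))\<^sup>2)"
  have "continuous_on R \<Phi>"
    unfolding \<Phi>_def by (intro continuous_intros contuF contw)
  then obtain q where q: "q \<in> R" "\<And>x. x \<in> R \<Longrightarrow> \<Phi> x \<le> \<Phi> q"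
    using continuous_attains_sup[OF R] R0 by blast
  have \<Phi>q: "c \<le> \<Phi> q" using q(2)[OF R0] uc by (simp add: \<Phi>_def w0)
  have N: "0 \<le> N" by (simp add: N_def)
  have fq: "cmod (fst q) \<le> r" and wq: "cmod (w \<delta> (fst q) (snd q)) \<le> \<delta> / 4"
    using q(1) by (auto simp: R_def)
  have fq2: "(cmod (fst q))\<^sup>2 \<le> r\<^sup>2" using fq by (intro power_mono) auto
  have "cmod (fst q) \<noteq> r"
  proof
    assume "cmod (fst q) = r"
    then have "F (fst q) (snd q) \<in> K"
      using below[OF \<delta>(1,2) fq wq] small[OF \<delta>(1,2) fq wq] \<delta>(1) unfolding K_def by (intro imageI) (auto simp: mem_Times_iff)
    then have "u (F (fst q) (snd q)) \<le> M" by (rule M)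
    moreover have "0 \<le> N * (cmod (w \<delta> (fst q) (snd q)))\<^sup>2" using N by simp
    ultimately show False using \<Phi>q fq2 by (simp add: \<Phi>_def c_def)
  qed
  moreover have "cmod (w \<delta> (fst q) (snd q)) \<noteq> \<delta> / 4"
  proof
    assume eq: "cmod (w \<delta> (fst q) (snd q)) = \<delta> / 4"
    have "N * (cmod (w \<delta> (fst q) (snd q)))\<^sup>2 = \<bar>m\<bar> + r\<^sup>2 + \<bar>c\<bar> + 1"
      unfolding eq N_def using \<delta>(1) nonzero_eq_divide_eq[of "(\<delta> / 4)\<^sup>2"] by (metis divide_eq_0_iff less_irrefl power_not_zero zero_neq_numeral)
    then show False using \<Phi>q fq2 m[OF q(1)] by (simp add: \<Phi>_def)
  qed
  ultimately have int: "cmod (fst q) < r" "cmod (w \<delta> (fst q) (snd q)) < \<delta> / 4" using fq wq by auto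
  show False
  proof (rule psh_no_interior_max[OF u, where a = a and d = "of_real \<delta>" and r = r and \<sigma> = "\<delta> / 4"
        and p = p and t = t and \<nu> = \<nu> and N = N and \<zeta>\<^sub>1 = "fst q" and \<tau>\<^sub>1 = "snd q"])
    show "p + \<zeta> *s t + \<tau> *s \<nu> \<in> D"
      if "cmod \<zeta> \<le> r" "cmod (\<tau> + a * \<zeta>\<^sup>2 + of_real \<delta>) \<le> \<delta> / 4" for \<zeta> \<tau>
      using inD[OF \<delta>(1,2), of \<zeta> \<tau>] that by (simp add: F_def w_def)
    show "u (p + \<zeta> *s t + \<tau> *s \<nu>) - N * (cmod (\<tau> + a * \<zeta>\<^sup>2 + of_real \<delta>))\<^sup>2 + (cmod \<zeta>)\<^sup>2
      \<le> u (p + fst q *s t + snd q *s \<nu>) - N * (cmod (snd q + a * (fst q)\<^sup>2 + of_real \<delta>))\<^sup>2 + (cmod (fst q))\<^sup>2"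
      if "cmod \<zeta> \<le> r" "cmod (\<tau> + a * \<zeta>\<^sup>2 + of_real \<delta>) \<le> \<delta> / 4" for \<zeta> \<tau>
      using q(2)[of "(\<zeta>, \<tau>)"] that by (simp add: \<Phi>_def R_def F_def w_def)
  qed (use int in \<open>auto simp: w_def\<close>)
qed

section \<open>From Stein neighborhoods to the Steinness index\<close>

lemma norm_smult_complex_vec: "norm (c *s (v::complex^'n::finite)) = cmod c * norm v"
  by (simp add: norm_vec_def norm_mult L2_set_right_distrib)

lemma inner_i_smult_self: "(\<i> *s (v::complex^'n::finite)) \<bullet> v = 0"
  by (simp add: inner_vec_def inner_complex_def)

lemma d2_bounded_on_compact:
  fixes \<rho> :: "'a::euclidean_space \<Rightarrow> real"
  assumes S: "open S" "Ck_on 2 \<rho> S" and K: "compact K" "K \<subseteq> S"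
  obtains B where "0 \<le> B" "\<And>z a b. z \<in> K \<Longrightarrow> \<bar>d2 \<rho> z a b\<bar> \<le> B * norm a * norm b"
proof -
  define G where "G = (\<lambda>z. \<Sum>i\<in>Basis. \<Sum>j\<in>Basis. \<bar>d2 \<rho> z i j\<bar>)"
  have "continuous_on K G"
    unfolding G_def
    using C2_continuous_derivative(2)[OF S(2)] K(2) continuous_on_subset
    by (intro continuous_intros) blast
  then have "bounded (G ` K)"
    using K(1) compact_continuous_image compact_imp_bounded by blast
  then obtain B where B: "\<And>z. z \<in> K \<Longrightarrow> G z \<le> B"
    unfolding bounded_iff by (force simp: abs_le_iff)
  show thesis
  proof (rule that[of "max B 0"])
    fix z a b assume z: "z \<in> K"
    then have zS: "z \<in> S" using K by blast
    have "d2 \<rho> z a b = d2 \<rho> z (\<Sum>i\<in>Basis. (a \<bullet> i) *\<^sub>R i) b" by (simp add: euclidean_representation)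
    also have "\<dots> = (\<Sum>i\<in>Basis. (a \<bullet> i) * d2 \<rho> z i b)"
      using d2_linear1[OF S zS, of b] by (simp add: linear_sum[of "\<lambda>a. d2 \<rho> z a b"] linear_scale[of "\<lambda>a. d2 \<rho> z a b"])
    also have "\<dots> = (\<Sum>i\<in>Basis. (a \<bullet> i) * d2 \<rho> z i (\<Sum>j\<in>Basis. (b \<bullet> j) *\<^sub>R j))" by (simp add: euclidean_representation)
    also have "\<dots> = (\<Sum>i\<in>Basis. (a \<bullet> i) * (\<Sum>j\<in>Basis. (b \<bullet> j) * d2 \<rho> z i j))"
      using d2_linear2[OF S zS] by (simp add: linear_sum linear_scale)
    also have "\<bar>\<dots>\<bar> \<le> (\<Sum>i\<in>Basis. \<Sum>j\<in>Basis. norm a * norm b * \<bar>d2 \<rho> z i j\<bar>)"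
    proof -
      have "\<bar>(a \<bullet> i) * ((b \<bullet> j) * d2 \<rho> z i j)\<bar> \<le> norm a * norm b * \<bar>d2 \<rho> z i j\<bar>"
        if "i \<in> Basis" "j \<in> Basis" for i j
        using Basis_le_norm[OF that(1), of a] Basis_le_norm[OF that(2), of b]
        by (simp add: abs_mult mult_mono flip: mult.assoc)
      then show ?thesis
        unfolding sum_distrib_left
        by (intro order_trans[OF sum_abs] sum_mono) 
    qed
    also have "\<dots> = norm a * norm b * G z" by (simp add: G_def sum_distrib_left)
    also have "\<dots> \<le> norm a * norm b * max B 0"
      using B[OF z] by (intro mult_left_mono) auto
    finally show "\<bar>d2 \<rho> z a b\<bar> \<le> max B 0 * norm a * norm b" by (simp add: mult_ac)
  qed simp
qed

text \<open>Removing from \<open>w\<close> its complex normal part \<open>n\<close> leaves a tangent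
  vector, and all terms containing \<open>n\<close> are bounded by
  \<open>|\<partial>\<rho>(w)| |w|\<close>. The constant is uniform on \<open>K\<close>, while the
  tangential inequality is assumed at the single point \<open>z\<close>: in the application it is
  known only on the part of \<open>K\<close> outside the domain.\<close>

lemma levi_lower_bound_on_compact:
  fixes \<rho> :: "complex^'n::finite \<Rightarrow> real"
  assumes S: "open S" "Ck_on 2 \<rho> S" and K: "compact K" "K \<subseteq> S"
    and nz: "\<And>z. z \<in> K \<Longrightarrow> frechet_derivative \<rho> (at z) \<noteq> (\<lambda>_. 0)"
  obtains C where "0 \<le> C"
    "\<And>z w. z \<in> K \<Longrightarrow>
      (\<And>t. frechet_derivative \<rho> (at z) t = 0 \<Longrightarrow> frechet_derivative \<rho> (at z) (\<i> *s t) = 0 \<Longrightarrow>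
        0 \<le> d2 \<rho> z t t + d2 \<rho> z (\<i> *s t) (\<i> *s t)) \<Longrightarrow>
      - C * sqrt ((frechet_derivative \<rho> (at z) w)\<^sup>2 + (frechet_derivative \<rho> (at z) (\<i> *s w))\<^sup>2) * norm w
      \<le> d2 \<rho> z w w + d2 \<rho> z (\<i> *s w) (\<i> *s w)"
proof -
  obtain B where B: "0 \<le> B" "\<And>z a b. z \<in> K \<Longrightarrow> \<bar>d2 \<rho> z a b\<bar> \<le> B * norm a * norm b"
    using d2_bounded_on_compact[OF S K] by blast
  define g where "g = (\<lambda>z. \<Sum>b\<in>Basis. frechet_derivative \<rho> (at z) b *\<^sub>R b)"
  have Dg: "frechet_derivative \<rho> (at z) v = g z \<bullet> v" if "z \<in> K" for z v
  proof -
    have lin: "linear (frechet_derivative \<rho> (at z))" using C2_linear[OF S] that K by blast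
    have "frechet_derivative \<rho> (at z) v = frechet_derivative \<rho> (at z) (\<Sum>b\<in>Basis. (v \<bullet> b) *\<^sub>R b)"
      by (simp add: euclidean_representation)
    also have "\<dots> = g z \<bullet> v"
      by (simp add: linear_sum[OF lin] linear_scale[OF lin] g_def inner_sum_left inner_commute[of v] mult.commute)
    finally show ?thesis .
  qed
  have contg: "continuous_on K (\<lambda>z. norm (g z))"
    unfolding g_def using C2_continuous_derivative(1)[OF S(2)] K(2) continuous_on_subset
    by (intro continuous_intros) blast
  obtain m where m: "0 < m" "\<And>z. z \<in> K \<Longrightarrow> m \<le> norm (g z)"
  proof (cases "K = {}")
    case False
    then obtain z0 where z0: "z0 \<in> K" "\<And>z. z \<in> K \<Longrightarrow> norm (g z0) \<le> norm (g z)"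
      using continuous_attains_inf[OF K(1) _ contg] by blast
    have "g z0 \<noteq> 0" using nz[OF z0(1)] Dg[OF z0(1)] by (metis ext inner_zero_left)
    then show thesis using that[of "norm (g z0)"] z0(2) by simp
  qed (use that[of 1] in auto)
  show thesis
  \<comment> \<open>For each of \<open>w\<close> and \<open>\<i> *s w\<close> the two cross terms
    and the square of the normal part cost \<open>3 + 3 + 2\<close> units of
    \<open>l\<close>.\<close>
  proof (rule that[of "16 * B / m"])
    show "0 \<le> 16 * B / m" using B(1) m(1) by simp
    fix z w assume z: "z \<in> K" and tang: "\<And>t. frechet_derivative \<rho> (at z) t = 0 \<Longrightarrow>
       frechet_derivative \<rho> (at z) (\<i> *s t) = 0 \<Longrightarrow> 0 \<le> d2 \<rho> z t t + d2 \<rho> z (\<i> *s t) (\<i> *s t)"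
    have zS: "z \<in> S" using z K by blast
    define P Q where "P = g z \<bullet> w" and "Q = g z \<bullet> (\<i> *s w)"
    define s where "s = sqrt (P\<^sup>2 + Q\<^sup>2)"
    have gz: "0 < norm (g z)" using m z by (meson less_le_trans)
    define q where "q = g z \<bullet> g z"
    have q: "0 < q" using gz by (simp add: q_def)
    \<comment> \<open>The choice gives \<open>n\<close> the same two derivatives as
      \<open>w\<close>, namely \<open>P\<close> in direction \<open>n\<close> and \<open>Q\<close>
      in direction \<open>\<i> *s n\<close>, so that \<open>w - n\<close> is complex
      tangential.\<close>
    define c where "c = Complex (P / q) (- Q / q)"
    define n where "n = c *s g z"
    define t where "t = w - n"
    have lin: "linear (frechet_derivative \<rho> (at z))" by (rule C2_linear[OF S zS])
    have gig: "g z \<bullet> (\<i> *s g z) = 0" using inner_i_smult_self by (simp add: inner_commute)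
    have "g z \<bullet> n = P"
      using linear_complex_smult[OF lin, where c = c and v = "g z"] q
      by (simp add: Dg[OF z] gig n_def c_def flip: q_def)
    moreover have "g z \<bullet> (\<i> *s n) = Q"
      using linear_complex_smult[OF lin, where c = "\<i> * c" and v = "g z"] q
      by (simp add: Dg[OF z] gig n_def c_def flip: q_def)
    moreover have it: "\<i> *s t = \<i> *s w - \<i> *s n" by (simp add: t_def vec_eq_iff algebra_simps)
    ultimately have t: "0 \<le> d2 \<rho> z t t + d2 \<rho> z (\<i> *s t) (\<i> *s t)"
      by (intro tang) (simp_all add: Dg[OF z] it P_def Q_def, simp add: t_def inner_diff_right P_def, simp add: inner_diff_right)
    have "q = (norm (g z))\<^sup>2" by (simp add: q_def power2_norm_eq_inner)
    have cmodc: "cmod c = s / q"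
      using q by (simp add: c_def cmod_def s_def power_divide real_sqrt_divide flip: add_divide_distrib)
    have "norm n = s / norm (g z)"
      using gz by (simp add: n_def norm_smult_complex_vec cmodc \<open>q = (norm (g z))\<^sup>2\<close> power2_eq_square)
    also have "\<dots> \<le> s / m" using m z gz by (intro divide_left_mono) (auto simp: s_def)
    finally have n1: "norm n \<le> s / m" .
    have n2: "norm n \<le> 2 * norm w"
    proof -
      have "\<bar>P\<bar> \<le> norm (g z) * norm w" "\<bar>Q\<bar> \<le> norm (g z) * norm w"
        using Cauchy_Schwarz_ineq2[of "g z" w] Cauchy_Schwarz_ineq2[of "g z" "\<i> *s w"]
        by (simp_all add: P_def Q_def norm_smult_complex_vec)
      then have "s \<le> norm (g z) * (2 * norm w)"
        unfolding s_def using sqrt_sum_squares_le_sum_abs[of P Q] by linarith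
      then show ?thesis unfolding \<open>norm n = s / norm (g z)\<close> using gz by (simp add: field_simps)
    qed
    have t3: "norm t \<le> 3 * norm w" using norm_triangle_ineq4[of w n] n2 by (simp add: t_def)
    define l where "l = B / m * s * norm w"
    have exp: "d2 \<rho> z (x + y) (x + y) \<ge> d2 \<rho> z x x - 8 * l"
      if "norm x \<le> 3 * norm w" "norm y = norm n" for x y
    proof -
      have "d2 \<rho> z (x + y) (x + y) = d2 \<rho> z x x + d2 \<rho> z x y + d2 \<rho> z y x + d2 \<rho> z y y"
        using linear_add[OF d2_linear1[OF S zS]] linear_add[OF d2_linear2[OF S zS]] by simp
      moreover have "\<bar>d2 \<rho> z x y\<bar> \<le> 3 * l"
      proof -
        have "\<bar>d2 \<rho> z x y\<bar> \<le> B * (3 * norm w) * (s / m)"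
          by (rule order_trans[OF B(2)[OF z]], intro mult_mono) (use that n1 B in auto)
        then show ?thesis by (simp add: l_def mult_ac)
      qed
      moreover have "\<bar>d2 \<rho> z y x\<bar> \<le> 3 * l"
      proof -
        have "\<bar>d2 \<rho> z y x\<bar> \<le> B * (s / m) * (3 * norm w)"
          by (rule order_trans[OF B(2)[OF z]], intro mult_mono) (use that n1 B m in \<open>auto simp: s_def\<close>)
        then show ?thesis by (simp add: l_def mult_ac)
      qed
      moreover have "\<bar>d2 \<rho> z y y\<bar> \<le> 2 * l"
      proof -
        have "\<bar>d2 \<rho> z y y\<bar> \<le> B * (2 * norm w) * (s / m)"
          by (rule order_trans[OF B(2)[OF z]], intro mult_mono) (use that n1 n2 B in auto)
        then show ?thesis by (simp add: l_def mult_ac)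
      qed
      ultimately show ?thesis by linarith
    qed
    have "d2 \<rho> z w w \<ge> d2 \<rho> z t t - 8 * l"
      using exp[of t n] t3 by (simp add: t_def)
    moreover have "d2 \<rho> z (\<i> *s w) (\<i> *s w) \<ge> d2 \<rho> z (\<i> *s t) (\<i> *s t) - 8 * l"
    proof -
      have "norm (\<i> *s t) \<le> 3 * norm w" using t3 by (simp add: norm_smult_complex_vec)
      moreover have "\<i> *s t + \<i> *s n = \<i> *s w" by (simp add: it)
      ultimately show ?thesis
        using exp[of "\<i> *s t" "\<i> *s n"] norm_smult_complex_vec[of \<i> n] by simp
    qed
    ultimately have "- 16 * l \<le> d2 \<rho> z w w + d2 \<rho> z (\<i> *s w) (\<i> *s w)"
      using t by linarith
    moreover have "- (16 * B / m) * s * norm w = - 16 * l" by (simp add: l_def)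
    ultimately have "- (16 * B / m) * s * norm w \<le> d2 \<rho> z w w + d2 \<rho> z (\<i> *s w) (\<i> *s w)"
      by (simp only:)
    then show "- (16 * B / m) * sqrt ((frechet_derivative \<rho> (at z) w)\<^sup>2 + (frechet_derivative \<rho> (at z) (\<i> *s w))\<^sup>2) * norm w
      \<le> d2 \<rho> z w w + d2 \<rho> z (\<i> *s w) (\<i> *s w)"
      by (simp add: Dg[OF z] s_def P_def Q_def)
  qed
qed

text \<open>Here \<open>X\<close> stands for the scaled gradient of \<open>\<rho>\<close> on
  \<open>w\<close>, \<open>Z\<close> for that of \<open>|z|\<^sup>2\<close>, and \<open>n\<close>
  for \<open>|w|\<close>. Completing the square in \<open>X\<close> about \<open>b\<close> leaves
  \<open>- a C Z n - C\<^sup>2 n\<^sup>2 / 4\<close>. One copy of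
  \<open>a (n\<^sup>2 + K Z\<^sup>2)\<close> absorbs the first term, the other absorbs the second
  and leaves \<open>n\<^sup>2\<close>, which beats what remains of \<open>X\<^sup>2 / \<eta>\<close>
  because \<open>\<eta>\<close> is large.\<close>

lemma levi_quadratic_positive:
  fixes C R a \<eta> n X Z :: real
  assumes "0 \<le> C" "0 \<le> R" and K: "C\<^sup>2 \<le> K" and a: "C\<^sup>2 / 4 + 1 \<le> a" "a \<le> A"
    and \<eta>: "2 \<le> \<eta>" "2 * (A * R + C)\<^sup>2 < \<eta>"
    and n: "0 < n" and X: "0 \<le> X" and Z: "0 \<le> Z" "Z \<le> R * n"
  shows "0 < - C * X * n - X\<^sup>2 / \<eta> + 2 * a * (n\<^sup>2 + K * Z\<^sup>2) + (X - a * Z)\<^sup>2"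
proof -
  define b where "b = a * Z + C * n / 2"
  have a0: "0 < a" using a(1) by (smt (verit) divide_nonneg_nonneg zero_le_power2)
  have b0: "0 \<le> b" using a0 Z n assms(1) by (simp add: b_def)
  have "b \<le> (A * R + C) * n"
  proof -
    have "a * Z \<le> A * (R * n)" using a0 a(2) Z by (intro mult_mono) auto
    moreover have "C * n / 2 \<le> C * n" using assms(1) n by simp
    ultimately show ?thesis by (simp add: b_def algebra_simps)
  qed
  then have "b\<^sup>2 \<le> ((A * R + C) * n)\<^sup>2" using b0 by (intro power_mono)
  then have "2 * b\<^sup>2 \<le> 2 * (A * R + C)\<^sup>2 * n\<^sup>2" by (simp add: power_mult_distrib)
  also have "\<dots> < \<eta> * n\<^sup>2" using \<eta>(2) n by (intro mult_strict_right_mono) auto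
  finally have bn: "2 * b\<^sup>2 / \<eta> < n\<^sup>2" using \<eta>(1) by (simp add: divide_less_eq mult.commute)
  have "C * Z * n \<le> n\<^sup>2 + C\<^sup>2 * Z\<^sup>2 / 4"
    using zero_le_power2[of "n - C * Z / 2"] by (simp add: power2_eq_square field_simps)
  also have "C\<^sup>2 * Z\<^sup>2 / 4 \<le> K * Z\<^sup>2"
  proof -
    have "C\<^sup>2 / 4 * Z\<^sup>2 \<le> K * Z\<^sup>2" using K zero_le_power2[of C] by (intro mult_right_mono) (linarith, simp)
    then show ?thesis by simp
  qed
  finally have "a * (C * Z * n) \<le> a * (n\<^sup>2 + K * Z\<^sup>2)" using a0 by simp
  moreover have "(C\<^sup>2 / 4 + 1) * n\<^sup>2 \<le> a * (n\<^sup>2 + K * Z\<^sup>2)"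
  proof -
    have "0 \<le> K * Z\<^sup>2" using K by (meson mult_nonneg_nonneg order_trans zero_le_power2)
    then show ?thesis using a(1) a0 by (intro mult_mono) auto
  qed
  moreover have "- (2 * b\<^sup>2 / \<eta>) \<le> (X - b)\<^sup>2 - X\<^sup>2 / \<eta>"
  proof -
    have "X\<^sup>2 \<le> 2 * (X - b)\<^sup>2 + 2 * b\<^sup>2"
      using zero_le_power2[of "X - 2 * b"] by (simp add: power2_eq_square algebra_simps)
    then have "X\<^sup>2 / \<eta> \<le> (2 * (X - b)\<^sup>2 + 2 * b\<^sup>2) / \<eta>" using \<eta>(1) by (intro divide_right_mono) auto
    also have "\<dots> = 2 / \<eta> * (X - b)\<^sup>2 + 2 * b\<^sup>2 / \<eta>" by (simp add: add_divide_distrib)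
    also have "2 / \<eta> * (X - b)\<^sup>2 \<le> 1 * (X - b)\<^sup>2" using \<eta>(1) by (intro mult_right_mono) auto
    finally show ?thesis by simp
  qed
  moreover have "- C * X * n - X\<^sup>2 / \<eta> + 2 * a * (n\<^sup>2 + K * Z\<^sup>2) + (X - a * Z)\<^sup>2
     = ((X - b)\<^sup>2 - X\<^sup>2 / \<eta>) + 2 * (a * (n\<^sup>2 + K * Z\<^sup>2)) - a * (C * Z * n) - C\<^sup>2 / 4 * n\<^sup>2"
    by (simp add: b_def power2_eq_square algebra_simps)
  ultimately show ?thesis using bn by (simp add: algebra_simps)
qed

text \<open>For \<open>exp h\<close> the second derivative is
  \<open>exp h (h'' + h'\<^sup>2)\<close>. The logarithm contributes the negative term in
  \<open>h''\<close>, of order \<open>1 / \<eta>\<close> relative to the square of its own gradient;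
  \<open>a * (z \<bullet> v)\<close> is the derivative of \<open>N exp (K |z|\<^sup>2)\<close> in
  direction \<open>v\<close>.\<close>

lemma d2_exp_potential:
  fixes \<rho> :: "'a::real_inner \<Rightarrow> real" and N K :: real
  assumes S: "open S" "Ck_on 2 \<rho> S" "z \<in> S" and pos: "\<And>x. x \<in> S \<Longrightarrow> 0 < \<rho> x"
  defines "a \<equiv> 2 * N * K * exp (K * (z \<bullet> z))"
  shows "d2 (\<lambda>x. exp (\<eta> * ln (\<rho> x) + N * exp (K * (x \<bullet> x)))) z v v =
    exp (\<eta> * ln (\<rho> z) + N * exp (K * (z \<bullet> z))) *
     (\<eta> * d2 \<rho> z v v / \<rho> z - \<eta> * (frechet_derivative \<rho> (at z) v / \<rho> z)\<^sup>2
      + a * (v \<bullet> v + 2 * K * (z \<bullet> v)\<^sup>2)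
      + (\<eta> * frechet_derivative \<rho> (at z) v / \<rho> z + a * (z \<bullet> v))\<^sup>2)"
proof -
  let ?E = "\<lambda>x. exp (\<eta> * ln (\<rho> x) + N * exp (K * (x \<bullet> x)))"
  let ?D = "\<lambda>x v. frechet_derivative \<rho> (at x) v"
  have 1: "(?E has_derivative (\<lambda>h. ?E x * (\<eta> * ?D x h / \<rho> x + 2 * N * K * exp (K * (x \<bullet> x)) * (x \<bullet> h)))) (at x)"
    if "x \<in> S" for x
    using pos[OF that]
    by (auto intro!: derivative_eq_intros C2_has_derivative[OF S(1,2) that] ext simp: inner_commute divide_inverse algebra_simps)
  have 2: "((\<lambda>x. ?E x * (\<eta> * ?D x v / \<rho> x + 2 * N * K * exp (K * (x \<bullet> x)) * (x \<bullet> v))) has_derivative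
     (\<lambda>h. ?E z * (\<eta> * ?D z h / \<rho> z + a * (z \<bullet> h)) * (\<eta> * ?D z v / \<rho> z + a * (z \<bullet> v))
       + ?E z * (\<eta> * d2 \<rho> z h v / \<rho> z - \<eta> * ?D z v * ?D z h / (\<rho> z)\<^sup>2
         + 2 * K * a * (z \<bullet> h) * (z \<bullet> v) + a * (h \<bullet> v)))) (at z)"
  proof -
    have "\<rho> z \<noteq> 0" using pos[OF S(3)] by simp
    note d = C2_has_derivative[OF S] C2_has_derivative2[OF S, of v]
    have q: "((\<lambda>x. \<eta> * ?D x v / \<rho> x) has_derivative (\<lambda>h. \<eta> * d2 \<rho> z h v / \<rho> z - \<eta> * ?D z v * ?D z h / (\<rho> z)\<^sup>2)) (at z)"
      using \<open>\<rho> z \<noteq> 0\<close>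
      by (auto intro!: derivative_eq_intros d ext simp: power2_eq_square field_simps)
    have e: "((\<lambda>x. 2 * N * K * exp (K * (x \<bullet> x)) * (x \<bullet> v)) has_derivative
       (\<lambda>h. 2 * K * a * (z \<bullet> h) * (z \<bullet> v) + a * (h \<bullet> v))) (at z)"
      unfolding a_def by (auto intro!: derivative_eq_intros ext simp: inner_commute algebra_simps)
    show ?thesis
      by (rule has_derivative_eq_rhs[OF has_derivative_mult[OF 1[OF S(3)] has_derivative_add[OF q e]]])
        (auto simp: a_def algebra_simps)
  qed
  show ?thesis
    by (rule trans[OF d2_eqI[OF S(1,3) 1 2]]) (simp_all add: power2_eq_square algebra_simps add_divide_distrib)
qed


lemma steinness_index_finite_if_strong_stein:
  fixes D :: "(complex^'n::finite) set"
  assumes "open D" "bounded D" "strong_stein_nbhd_basis D"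
  shows "steinness_index D < \<infinity>"
proof -
  obtain V \<rho> e0 where def: "defining_function D V \<rho>" and e0: "0 < e0"
    and pc: "\<And>e. 0 \<le> e \<Longrightarrow> e < e0 \<Longrightarrow> pseudoconvex {z\<in>V. \<rho> z < e}"
    using assms(3) unfolding strong_stein_nbhd_basis_def by blast
  have V: "open V" "closure D \<subseteq> V" "D = {z\<in>V. \<rho> z < 0}" and C2: "Ck_on 2 \<rho> V"
    and smooth: "smooth_on \<rho> V" and fr: "\<And>p. p \<in> frontier D \<Longrightarrow> frechet_derivative \<rho> (at p) \<noteq> (\<lambda>_. 0)"
    using def by (auto simp: defining_function_def smooth_on_def)
  have cont: "continuous_on V \<rho>" using C2 by (rule Ck_on_continuous)
  have frV: "p \<in> V" "\<rho> p = 0" if "p \<in> frontier D" for p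
  proof -
    show "p \<in> V" using that V(2) by (auto simp: frontier_def)
    then have "\<rho> p \<le> 0" using nonpos_on_closure[OF V(1,3) cont] that by (simp add: frontier_def)
    moreover have "p \<notin> D" using that assms(1) by (simp add: frontier_def interior_open)
    ultimately show "\<rho> p = 0" using V(3) \<open>p \<in> V\<close> by force
  qed
  \<comment> \<open>The bound \<open>\<rho> z < e0\<close> makes the level of each point admissible:
    for \<open>z\<close> in \<open>W\<close> outside the domain, the sublevel set
    \<open>{\<rho> < \<rho> z}\<close> is pseudoconvex.\<close>
  define W where "W = {z\<in>V. frechet_derivative \<rho> (at z) \<noteq> (\<lambda>_. 0)} \<inter> {z\<in>V. \<rho> z < e0}"
  have "open W" unfolding W_def using open_noncritical[OF V(1) C2] open_sublevel[OF V(1) cont] by blast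
  moreover have "frontier D \<subseteq> W" using fr frV e0 by (auto simp: W_def)
  moreover have "compact (frontier D)" using assms(2) compact_frontier_bounded by blast
  ultimately obtain U where U: "open U" "frontier D \<subseteq> U" "closure U \<subseteq> W" "compact (closure U)"
    using compact_open_bounded_nbhd by metis
  have UV: "closure U \<subseteq> V" using U(3) by (auto simp: W_def)
  define T where "T = U - closure D"
  have T: "open T" "T \<subseteq> closure U" "T \<subseteq> V"
    using U(1) UV closure_subset[of U] by (auto simp: T_def)
  have pos: "0 < \<rho> z" if "z \<in> T" for z
  proof -
    have "z \<in> W" using that T(2) U(3) by blast
    then show ?thesis
      using pos_outside_closure[OF V(1,3) _ _ C2_has_derivative[OF V(1) C2]] that by (auto simp: W_def T_def)
  qed
  have C2T: "Ck_on 2 \<rho> T" using C2 T(3) by (rule Ck_on_subset)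
  obtain C where C: "0 \<le> C" and
    levi: "\<And>z w. z \<in> closure U \<Longrightarrow>
      (\<And>t. frechet_derivative \<rho> (at z) t = 0 \<Longrightarrow> frechet_derivative \<rho> (at z) (\<i> *s t) = 0 \<Longrightarrow>
        0 \<le> d2 \<rho> z t t + d2 \<rho> z (\<i> *s t) (\<i> *s t)) \<Longrightarrow>
      - C * sqrt ((frechet_derivative \<rho> (at z) w)\<^sup>2 + (frechet_derivative \<rho> (at z) (\<i> *s w))\<^sup>2) * norm w
      \<le> d2 \<rho> z w w + d2 \<rho> z (\<i> *s w) (\<i> *s w)"
    using levi_lower_bound_on_compact[OF V(1) C2 U(4) UV] U(3) by (auto simp: W_def)
  have tang: "0 \<le> d2 \<rho> z t t + d2 \<rho> z (\<i> *s t) (\<i> *s t)"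
    if "z \<in> T" "frechet_derivative \<rho> (at z) t = 0" "frechet_derivative \<rho> (at z) (\<i> *s t) = 0" for z t
  proof (rule pseudoconvex_levi_nonneg[OF V(1) C2 _ pc _ _ that(2,3)])
    have "z \<in> W" using that(1) T(2) U(3) by blast
    then show "z \<in> V" "\<rho> z < e0" "frechet_derivative \<rho> (at z) \<noteq> (\<lambda>_. 0)" by (auto simp: W_def)
    show "0 \<le> \<rho> z" using pos[OF that(1)] by simp
  qed auto
  obtain R0 where R0: "0 < R0" "\<And>z. z \<in> closure U \<Longrightarrow> norm z \<le> R0"
    using U(4) compact_imp_bounded bounded_pos by metis
  \<comment> \<open>The factor 2 comes from estimating the modulus \<open>Z\<close> by the sum of
    its two real components.\<close>
  define R where "R = 2 * R0"
  define K where "K = C\<^sup>2 + 1"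
  \<comment> \<open>\<open>N\<close> turns the lower bound \<open>2 N K\<close> of the coefficient
    \<open>a\<close> into \<open>C\<^sup>2 / 4 + 1\<close>, and \<open>A\<close> is its upper bound.
    Neither involves \<open>\<eta>\<close>, so \<open>\<eta>\<close> can be chosen last; dividing by
    it in \<open>M\<close> keeps the weight in \<open>\<sigma> powr \<eta>\<close> equal to
    \<open>exp (N exp (K |z|\<^sup>2))\<close>.\<close>
  define N where "N = (C\<^sup>2 / 4 + 1) / (2 * K)"
  define A where "A = 2 * N * K * exp (K * R0\<^sup>2)"
  define \<eta> where "\<eta> = 2 + 2 * (A * R + C)\<^sup>2"
  define M where "M = N / \<eta>"
  have K: "0 < K" "C\<^sup>2 \<le> K" by (simp_all add: K_def add_nonneg_pos)
  have NK: "2 * N * K = C\<^sup>2 / 4 + 1" using K by (simp add: N_def)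
  have \<eta>: "2 \<le> \<eta>" "2 * (A * R + C)\<^sup>2 < \<eta>" by (simp_all add: \<eta>_def)
  define \<sigma> where "\<sigma> = (\<lambda>z. \<rho> z * exp (M * exp (K * (z \<bullet> z))))"
  have smooth\<sigma>: "smooth_on \<sigma> V"
    using smooth unfolding smooth_on_def \<sigma>_def
    by (auto intro!: Ck_on_mult Ck_on_exp Ck_on_const Ck_on_inner_self V(1))
  have "frechet_derivative \<sigma> (at p) \<noteq> (\<lambda>_. 0)" if p: "p \<in> frontier D" for p
  proof -
    have "Ck_on (Suc 0) (\<lambda>z. exp (M * exp (K * (z \<bullet> z)))) V"
      by (intro Ck_on_mult Ck_on_exp Ck_on_const Ck_on_inner_self V(1))
    from Ck_on_Suc_has_derivative[OF this frV(1)[OF p]]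
    have "(\<sigma> has_derivative (\<lambda>h. frechet_derivative \<rho> (at p) h * exp (M * exp (K * (p \<bullet> p))))) (at p)"
      unfolding \<sigma>_def
      by (rule has_derivative_eq_rhs[OF has_derivative_mult[OF C2_has_derivative[OF V(1) C2 frV(1)[OF p]]]])
        (simp add: frV(2)[OF p])
    then have "frechet_derivative \<sigma> (at p) = (\<lambda>h. frechet_derivative \<rho> (at p) h * exp (M * exp (K * (p \<bullet> p))))"
      by (rule frechet_derivative_at[symmetric])
    then show ?thesis using fr[OF p] by (auto simp: fun_eq_iff)
  qed
  then have def\<sigma>: "defining_function D V \<sigma>"
    using V smooth\<sigma> by (auto simp: defining_function_def \<sigma>_def mult_less_0_iff)
  have "strictly_plurisubharmonic_on (\<lambda>z. \<sigma> z powr \<eta>) T"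
    unfolding strictly_plurisubharmonic_on_def
  proof (intro conjI ballI allI impI)
    have pos\<sigma>: "0 < \<sigma> z" if "z \<in> T" for z using pos[OF that] by (simp add: \<sigma>_def)
    have "Ck_on 2 \<sigma> T" using smooth\<sigma> T(3) Ck_on_subset unfolding smooth_on_def by blast
    then show C2\<sigma>: "Ck_on 2 (\<lambda>z. \<sigma> z powr \<eta>) T"
      using pos\<sigma> by (intro Ck_on_powr T(1))
    fix z w :: "complex^'n" assume z: "z \<in> T" and w: "w \<noteq> 0"
    let ?E = "\<lambda>x. exp (\<eta> * ln (\<rho> x) + N * exp (K * (x \<bullet> x)))"
    have pE: "\<sigma> x powr \<eta> = ?E x" if "x \<in> T" for x
    proof -
      have "ln (\<sigma> x) = ln (\<rho> x) + M * exp (K * (x \<bullet> x))"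
        using pos[OF that] by (simp add: \<sigma>_def ln_mult)
      moreover have "\<eta> * M = N" using \<eta>(1) by (simp add: M_def)
      ultimately show ?thesis
        using pos\<sigma>[OF that] by (simp add: powr_def distrib_left flip: mult.assoc)
    qed
    have d2E: "d2 (\<lambda>z. \<sigma> z powr \<eta>) z v v = d2 ?E z v v" for v
    proof -
      have "frechet_derivative (\<lambda>z. \<sigma> z powr \<eta>) (at y) v = frechet_derivative ?E (at y) v" if "y \<in> T" for y
        using frechet_derivative_cong_open[OF T(1) that pE] by simp
      then show ?thesis
        unfolding d2_def by (rule fun_cong[OF frechet_derivative_cong_open[OF T(1) z]])
    qed
    define a where "a = 2 * N * K * exp (K * (z \<bullet> z))"
    define X1 X2 Y1 Y2 where "X1 = \<eta> * frechet_derivative \<rho> (at z) w / \<rho> z"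
      and "X2 = \<eta> * frechet_derivative \<rho> (at z) (\<i> *s w) / \<rho> z"
      and "Y1 = z \<bullet> w" and "Y2 = z \<bullet> (\<i> *s w)"
    define X Z where "X = sqrt (X1\<^sup>2 + X2\<^sup>2)" and "Z = sqrt (Y1\<^sup>2 + Y2\<^sup>2)"
    have X2: "X\<^sup>2 = X1\<^sup>2 + X2\<^sup>2" and Z2: "Z\<^sup>2 = Y1\<^sup>2 + Y2\<^sup>2" by (simp_all add: X_def Z_def)
    have \<rho>z: "0 < \<rho> z" by (rule pos[OF z])
    have zR: "norm z \<le> R0" using z T(2) R0(2) by blast
    have a: "C\<^sup>2 / 4 + 1 \<le> a" "a \<le> A"
    proof -
      have "(C\<^sup>2 / 4 + 1) * 1 \<le> (C\<^sup>2 / 4 + 1) * exp (K * (z \<bullet> z))"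
        using K(1) by (intro mult_left_mono) auto
      then show "C\<^sup>2 / 4 + 1 \<le> a" by (simp add: a_def NK)
      have "z \<bullet> z \<le> R0\<^sup>2" using zR by (simp add: dot_square_norm power_mono)
      then show "a \<le> A" unfolding a_def A_def NK using K(1) by (intro mult_left_mono) auto
    qed
    have ZR: "Z \<le> R * norm w"
    proof -
      have "\<bar>Y1\<bar> \<le> R0 * norm w" "\<bar>Y2\<bar> \<le> R0 * norm w"
        unfolding Y1_def Y2_def
        by (rule order_trans[OF Cauchy_Schwarz_ineq2], use zR in \<open>simp add: mult_right_mono norm_smult_complex_vec\<close>)+
      then show ?thesis
        unfolding Z_def R_def using sqrt_sum_squares_le_sum_abs[of Y1 Y2] by linarith
    qed
    have "0 < - C * X * norm w - X\<^sup>2 / \<eta> + 2 * a * ((norm w)\<^sup>2 + K * Z\<^sup>2) + (X - a * Z)\<^sup>2"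
      using C R0(1) K(2) a \<eta> w ZR
      by (intro levi_quadratic_positive[where A = A and R = R]) (auto simp: R_def X_def Z_def)
    also have "\<dots> \<le> \<eta> * (d2 \<rho> z w w + d2 \<rho> z (\<i> *s w) (\<i> *s w)) / \<rho> z - X\<^sup>2 / \<eta>
        + 2 * a * ((norm w)\<^sup>2 + K * Z\<^sup>2) + ((X1 + a * Y1)\<^sup>2 + (X2 + a * Y2)\<^sup>2)"
    proof -
      have "X = \<eta> / \<rho> z * sqrt ((frechet_derivative \<rho> (at z) w)\<^sup>2 + (frechet_derivative \<rho> (at z) (\<i> *s w))\<^sup>2)"
      proof -
        have "X1\<^sup>2 + X2\<^sup>2 = (\<eta> / \<rho> z)\<^sup>2 * ((frechet_derivative \<rho> (at z) w)\<^sup>2 + (frechet_derivative \<rho> (at z) (\<i> *s w))\<^sup>2)"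
          by (simp add: X1_def X2_def power_mult_distrib power_divide distrib_left)
        then show ?thesis using \<rho>z \<eta>(1) by (simp add: X_def real_sqrt_mult)
      qed
      then have "- C * X * norm w = \<eta> / \<rho> z * (- C * sqrt ((frechet_derivative \<rho> (at z) w)\<^sup>2 + (frechet_derivative \<rho> (at z) (\<i> *s w))\<^sup>2) * norm w)"
        by simp
      also have "\<dots> \<le> \<eta> / \<rho> z * (d2 \<rho> z w w + d2 \<rho> z (\<i> *s w) (\<i> *s w))"
        using levi[of z w] tang[OF z] T(2) z \<rho>z \<eta>(1) by (intro mult_left_mono) auto
      finally have "- C * X * norm w \<le> \<eta> * (d2 \<rho> z w w + d2 \<rho> z (\<i> *s w) (\<i> *s w)) / \<rho> z" by simp
      \<comment> \<open>Cauchy-Schwarz in the plane reduces the two gradient values to their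
        lengths, the worst case being opposite directions.\<close>
      moreover have "(X - a * Z)\<^sup>2 \<le> (X1 + a * Y1)\<^sup>2 + (X2 + a * Y2)\<^sup>2"
      proof -
        have "\<bar>X1 * Y1 + X2 * Y2\<bar> \<le> X * Z"
          using Cauchy_Schwarz_ineq2[of "(X1, X2)" "(Y1, Y2)"] by (simp add: X_def Z_def norm_Pair)
        then have "- (X * Z) \<le> X1 * Y1 + X2 * Y2" by linarith
        moreover have "0 \<le> 2 * a" using a(1) by (smt (verit) divide_nonneg_nonneg zero_le_power2)
        ultimately have "2 * a * - (X * Z) \<le> 2 * a * (X1 * Y1 + X2 * Y2)" by (rule mult_left_mono)
        then show ?thesis
          using X2 Z2 unfolding power2_diff power2_sum power_mult_distrib by (simp add: algebra_simps)
      qed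
      ultimately show ?thesis by simp
    qed
    finally have main: "0 < \<dots>" .
    have "0 < ?E z * (\<eta> * (d2 \<rho> z w w + d2 \<rho> z (\<i> *s w) (\<i> *s w)) / \<rho> z - X\<^sup>2 / \<eta>
        + 2 * a * ((norm w)\<^sup>2 + K * Z\<^sup>2) + ((X1 + a * Y1)\<^sup>2 + (X2 + a * Y2)\<^sup>2))"
      using main by simp
    also have "\<dots> = d2 (\<lambda>z. \<sigma> z powr \<eta>) z w w + d2 (\<lambda>z. \<sigma> z powr \<eta>) z (\<i> *s w) (\<i> *s w)"
    proof -
      have i: "(\<i> *s w) \<bullet> (\<i> *s w) = (norm w)\<^sup>2" "w \<bullet> w = (norm w)\<^sup>2"
        by (simp_all add: dot_square_norm norm_smult_complex_vec)
      have X: "\<eta> * (x / \<rho> z)\<^sup>2 = (\<eta> * x / \<rho> z)\<^sup>2 / \<eta>" for x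
        using \<eta>(1) by (simp add: power2_eq_square)
      have exp: "d2 ?E z v v = ?E z * (\<eta> * d2 \<rho> z v v / \<rho> z - \<eta> * (frechet_derivative \<rho> (at z) v / \<rho> z)\<^sup>2
          + a * (v \<bullet> v + 2 * K * (z \<bullet> v)\<^sup>2) + (\<eta> * frechet_derivative \<rho> (at z) v / \<rho> z + a * (z \<bullet> v))\<^sup>2)" for v
        unfolding a_def by (rule d2_exp_potential[OF T(1) C2T z pos])
      show ?thesis
        unfolding d2E exp i X X1_def[symmetric] X2_def[symmetric] Y1_def[symmetric] Y2_def[symmetric] X2 Z2
        by (simp add: algebra_simps add_divide_distrib)
    qed
    also have "\<dots> = 4 * levi_form (\<lambda>z. \<sigma> z powr \<eta>) z w"
      by (simp add: levi_form_eq_d2[OF T(1) C2\<sigma> z])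
    finally show "0 < levi_form (\<lambda>z. \<sigma> z powr \<eta>) z w" by simp
  qed
  then have "steinness_exponent D V \<sigma> \<le> ereal \<eta>"
    unfolding steinness_exponent_def
    using \<eta>(1) U(1,2) UV closure_subset[of U] by (intro Inf_lower) (force simp: T_def)
  moreover have "steinness_index D \<le> steinness_exponent D V \<sigma>"
    unfolding steinness_index_def using def\<sigma> by (intro Inf_lower) blast
  ultimately show ?thesis by (metis ereal_less_PInfty order_le_less_trans order_trans less_ereal.simps(4) ereal_infty_less(1))
qed

lemma steinness_index_ge_1: "1 \<le> steinness_index D"
  unfolding steinness_index_def steinness_exponent_def
  by (intro Inf_greatest) (auto intro!: Inf_greatest)

theorem theorem4p1:
  fixes \<Omega> :: "(complex^'n::finite) set"
  assumes "CARD('n) \<ge> 2"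
    and "open \<Omega>" and "connected \<Omega>" and "\<Omega> \<noteq> {}" and "bounded \<Omega>"
    and "pseudoconvex \<Omega>"
    and "smooth_boundary \<Omega>"
  shows "(1 \<le> steinness_index \<Omega> \<and> steinness_index \<Omega> < \<infinity>) \<longleftrightarrow> strong_stein_nbhd_basis \<Omega>"
proof
  assume "1 \<le> steinness_index \<Omega> \<and> steinness_index \<Omega> < \<infinity>"
  then obtain V \<rho> where 1: "defining_function \<Omega> V \<rho>" "steinness_exponent \<Omega> V \<rho> < \<infinity>"
    unfolding steinness_index_def Inf_less_iff by blast
  then obtain \<eta> U where "1 < \<eta>" "open U" "frontier \<Omega> \<subseteq> U" "U \<subseteq> V"
    "strictly_plurisubharmonic_on (\<lambda>z. \<rho> z powr \<eta>) (U - closure \<Omega>)"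
    unfolding steinness_exponent_def Inf_less_iff by blast
  then show "strong_stein_nbhd_basis \<Omega>"
    using strong_stein_if_spsh_power[OF assms(2,5,6) 1(1), of \<eta> U] by simp
next
  assume "strong_stein_nbhd_basis \<Omega>"
  then show "1 \<le> steinness_index \<Omega> \<and> steinness_index \<Omega> < \<infinity>"
    using steinness_index_finite_if_strong_stein[OF assms(2,5)] steinness_index_ge_1 by blast
qed

end
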